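(* Let $(H,h)$ be an equivariant pair with $h(\infty)=\infty$, and regard $h$ as a homeomorphism of $\mathbb{C}$. Then $h$ has an asterisk: there is a point $z\in\mathbb{C}$ such that for every nonzero $v\in\mathbb{C}$ with rational real and imaginary parts the directional derivative $D_vh(z)=\lim_{t\to0}\frac{h(z+vt)-h(z)}{t}$ exists, and $D_1h(z)\neq0$.
   Context: $\mathbb{H}^3$ is the upper half space model $\mathbb{C}\times(0,\infty)$ of hyperbolic $3$-space with ideal boundary $S=\mathbb{C}\cup\{\infty\}$; $\mathcal{I}$ is its isometry group, acting also on $S$ by conformal transformations. A nice lattice is a subgroup $\Gamma\subset\mathcal{I}$ acting freely, properly discontinuously and cocompactly on $\mathbb{H}^3$. An equivariant pair $(H,h)$ consists of a bi-Lipschitz bijection $H:\mathbb{H}^3\to\mathbb{H}^3$ and a homeomorphism $h:S\to S$ such that $H\cup h$ is continuous on $\mathbb{H}^3\cup S$, together with nice lattices $\Gamma_1,\Gamma_2$ with $H\Gamma_1H^{-1}=\Gamma_2$ and $h\Gamma_1h^{-1}=\Gamma_2$. *)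

theory Defs
  imports "HOL-Analysis.Analysis"
begin

text \<open>Upper half space model of hyperbolic 3-space: points (z,t) with z complex, t > 0.\<close>
typedef H3 = "{p :: complex \<times> real. snd p > 0}" morphisms pt Abs_H3
  by (rule exI[of _ "(0, 1)"]) simp

text \<open>Ideal boundary S = C with infinity; None is the point at infinity.\<close>
type_synonym Sph = "complex option"

definition hdist :: "H3 \<Rightarrow> H3 \<Rightarrow> real" where
  "hdist p q = arcosh (1 + ((cmod (fst (pt p) - fst (pt q)))\<^sup>2 + (snd (pt p) - snd (pt q))\<^sup>2)
                           / (2 * snd (pt p) * snd (pt q)))"

text \<open>The compactification H3 \<union> S, embedded in R^3 \<union> {infinity}
  (points of R^3 = C \<times> R as Some, infinity as None), with the chordal metric.\<close>
definition emb :: "H3 + Sph \<Rightarrow> (complex \<times> real) option" where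
  "emb x = (case x of Inl p \<Rightarrow> Some (pt p)
                    | Inr None \<Rightarrow> None
                    | Inr (Some z) \<Rightarrow> Some (z, 0))"

fun cdist :: "(complex \<times> real) option \<Rightarrow> (complex \<times> real) option \<Rightarrow> real" where
  "cdist (Some (z, t)) (Some (w, s)) =
     2 * sqrt ((cmod (z - w))\<^sup>2 + (t - s)\<^sup>2)
       / sqrt ((1 + (cmod z)\<^sup>2 + t\<^sup>2) * (1 + (cmod w)\<^sup>2 + s\<^sup>2))"
| "cdist (Some (z, t)) None = 2 / sqrt (1 + (cmod z)\<^sup>2 + t\<^sup>2)"
| "cdist None (Some (w, s)) = 2 / sqrt (1 + (cmod w)\<^sup>2 + s\<^sup>2)"
| "cdist None None = 0"

text \<open>Continuity of a self-map of H3 \<union> S (w.r.t. the standard topology of the closed ball).\<close>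
definition cont_bar :: "(H3 + Sph \<Rightarrow> H3 + Sph) \<Rightarrow> bool" where
  "cont_bar F \<longleftrightarrow> (\<forall>x \<epsilon>. \<epsilon> > 0 \<longrightarrow> (\<exists>\<delta>>0. \<forall>y. cdist (emb y) (emb x) < \<delta>
                      \<longrightarrow> cdist (emb (F y)) (emb (F x)) < \<epsilon>))"

definition union_map :: "(H3 \<Rightarrow> H3) \<Rightarrow> (Sph \<Rightarrow> Sph) \<Rightarrow> H3 + Sph \<Rightarrow> H3 + Sph" where
  "union_map G g x = (case x of Inl p \<Rightarrow> Inl (G p) | Inr \<xi> \<Rightarrow> Inr (g \<xi>))"

text \<open>Continuity of a self-map of S (Riemann sphere topology = chordal metric).\<close>
definition cont_S :: "(Sph \<Rightarrow> Sph) \<Rightarrow> bool" where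
  "cont_S g \<longleftrightarrow> (\<forall>\<xi> \<epsilon>. \<epsilon> > 0 \<longrightarrow> (\<exists>\<delta>>0. \<forall>\<eta>. cdist (emb (Inr \<eta>)) (emb (Inr \<xi>)) < \<delta>
                      \<longrightarrow> cdist (emb (Inr (g \<eta>))) (emb (Inr (g \<xi>))) < \<epsilon>))"

definition homeo_S :: "(Sph \<Rightarrow> Sph) \<Rightarrow> bool" where
  "homeo_S g \<longleftrightarrow> bij g \<and> cont_S g \<and> cont_S (inv g)"

definition hyp_isometry :: "(H3 \<Rightarrow> H3) \<Rightarrow> bool" where
  "hyp_isometry G \<longleftrightarrow> bij G \<and> (\<forall>p q. hdist (G p) (G q) = hdist p q)"

definition bi_lipschitz :: "(H3 \<Rightarrow> H3) \<Rightarrow> bool" where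
  "bi_lipschitz H \<longleftrightarrow> (\<exists>L\<ge>1. \<forall>p q. hdist p q / L \<le> hdist (H p) (H q)
                                  \<and> hdist (H p) (H q) \<le> L * hdist p q)"

text \<open>The isometry group \<I>: an isometry G of H3 together with its action g on S
  (the boundary map making G \<union> g continuous on H3 \<union> S).\<close>
definition Isom :: "((H3 \<Rightarrow> H3) \<times> (Sph \<Rightarrow> Sph)) set" where
  "Isom = {(G, g). hyp_isometry G \<and> cont_bar (union_map G g)}"

definition nice_lattice :: "((H3 \<Rightarrow> H3) \<times> (Sph \<Rightarrow> Sph)) set \<Rightarrow> bool" where
  "nice_lattice \<Gamma> \<longleftrightarrow>
     \<Gamma> \<subseteq> Isom \<and>
     (id, id) \<in> \<Gamma> \<and>
     (\<forall>(G1, g1)\<in>\<Gamma>. \<forall>(G2, g2)\<in>\<Gamma>. (G1 \<circ> G2, g1 \<circ> g2) \<in> \<Gamma>) \<and>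
     (\<forall>(G, g)\<in>\<Gamma>. (inv G, inv g) \<in> \<Gamma>) \<and>
     \<comment> \<open>acts freely on H3\<close>
     (\<forall>(G, g)\<in>\<Gamma>. (\<exists>p. G p = p) \<longrightarrow> (G, g) = (id, id)) \<and>
     \<comment> \<open>properly discontinuously\<close>
     (\<forall>K. compact (pt ` K) \<longrightarrow> finite {\<gamma> \<in> \<Gamma>. fst \<gamma> ` K \<inter> K \<noteq> {}}) \<and>
     \<comment> \<open>cocompactly\<close>
     (\<exists>K. compact (pt ` K) \<and> (\<Union>\<gamma>\<in>\<Gamma>. fst \<gamma> ` K) = UNIV)"

definition equivariant_pair ::
  "(H3 \<Rightarrow> H3) \<Rightarrow> (Sph \<Rightarrow> Sph) \<Rightarrow> ((H3 \<Rightarrow> H3) \<times> (Sph \<Rightarrow> Sph)) set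
     \<Rightarrow> ((H3 \<Rightarrow> H3) \<times> (Sph \<Rightarrow> Sph)) set \<Rightarrow> bool" where
  "equivariant_pair H h \<Gamma>1 \<Gamma>2 \<longleftrightarrow>
     bij H \<and> bi_lipschitz H \<and> homeo_S h \<and> cont_bar (union_map H h) \<and>
     nice_lattice \<Gamma>1 \<and> nice_lattice \<Gamma>2 \<and>
     (\<lambda>\<gamma>. H \<circ> fst \<gamma> \<circ> inv H) ` \<Gamma>1 = fst ` \<Gamma>2 \<and>
     (\<lambda>\<gamma>. h \<circ> snd \<gamma> \<circ> inv h) ` \<Gamma>1 = snd ` \<Gamma>2"

definition has_dir_deriv :: "(complex \<Rightarrow> complex) \<Rightarrow> complex \<Rightarrow> complex \<Rightarrow> complex \<Rightarrow> bool" where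
  "has_dir_deriv f z v L \<longleftrightarrow>
     ((\<lambda>t::real. (f (z + v * of_real t) - f z) / of_real t) \<longlongrightarrow> L) (at 0)"

definition has_asterisk :: "(complex \<Rightarrow> complex) \<Rightarrow> bool" where
  "has_asterisk f \<longleftrightarrow> (\<exists>z. (\<forall>v. v \<noteq> 0 \<and> Re v \<in> \<rat> \<and> Im v \<in> \<rat> \<longrightarrow> (\<exists>L. has_dir_deriv f z v L))
                         \<and> (\<exists>L. has_dir_deriv f z 1 L \<and> L \<noteq> 0))"

end

theory Submission
  imports Defs
begin

text \<open>
  Isometries of hyperbolic space preserve the absolute cross ratio on the boundary. Given
  \<open>z\<close>, \<open>a\<close>, \<open>b\<close> with \<open>|a - z| \<le> |b - z|\<close>, cocompactness moves the point above \<open>z\<close> at height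
  \<open>|b - z|\<close> into a fixed compact set by an element of the first lattice; the images of the relevant
  pairs among \<open>z\<close>, \<open>a\<close>, \<open>b\<close>, \<open>\<infinity>\<close> are then uniformly separated. Since \<open>h\<close> conjugates this element into
  the second lattice, uniform continuity of the inverse of \<open>h\<close> bounds the cross ratio of the image
  points: \<open>|h a - h z| \<le> K |h b - h z|\<close>.

  By this weak quasisymmetry the squared increment of \<open>h\<close> over a short horizontal segment is at most a
  constant times the area of the image of the disc on that segment. Hence for almost every horizontal
  line the dyadic energies of the restriction of \<open>h\<close> to a unit segment are bounded (Tonelli and monotone
  convergence). A function of bounded dyadic energy is close in energy to its dyadic interpolations,
  so the Vitali covering lemma shows that it is differentiable almost everywhere, and that it is
  constant if the derivative vanishes almost everywhere. Applying this to \<open>h (v z + c)\<close>, almost every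
  point has all rational directional derivatives, and \<open>D\<^sub>1 h\<close> cannot vanish at almost all of them.
\<close>

section \<open>Chordal cross ratios\<close>

text \<open>Inverse stereographic projection onto the unit 3-sphere, infinity going to the pole
  \<open>(0, 1)\<close>. It turns \<open>cdist\<close> into a Euclidean distance, so that limits,
  the triangle inequality and compactness become available.\<close>

definition stereo :: "(complex \<times> real) option \<Rightarrow> (complex \<times> real) \<times> real" where
  "stereo x = (case x of None \<Rightarrow> (0, 1)
     | Some p \<Rightarrow> ((2 / (1 + (norm p)\<^sup>2)) *\<^sub>R p, ((norm p)\<^sup>2 - 1) / (1 + (norm p)\<^sup>2)))"

lemma norm_pair_squared: "(norm (z :: complex, t :: real))\<^sup>2 = (cmod z)\<^sup>2 + t\<^sup>2"
  by (simp add: norm_prod_def)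

lemma one_plus_norm_squared_pos: "1 + (norm p)\<^sup>2 > 0"
  by (simp add: add_pos_nonneg)

lemma cdist_Some: "cdist (Some p) (Some q) = 2 * norm (p - q) / sqrt ((1 + (norm p)\<^sup>2) * (1 + (norm q)\<^sup>2))"
  by (cases p; cases q) (simp add: norm_pair_squared add.assoc norm_prod_def)

lemma cdist_None:
  "cdist (Some p) None = 2 / sqrt (1 + (norm p)\<^sup>2)" "cdist None (Some p) = 2 / sqrt (1 + (norm p)\<^sup>2)"
  by (cases p; simp add: norm_pair_squared add.assoc)+

lemma norm_stereo: "norm (stereo x) = 1"
proof -
  have "(norm (stereo x))\<^sup>2 = 1"
  proof (cases x)
    case (Some p)
    have "(norm (stereo x))\<^sup>2
        = (2 / (1 + (norm p)\<^sup>2))\<^sup>2 * (norm p)\<^sup>2 + (((norm p)\<^sup>2 - 1) / (1 + (norm p)\<^sup>2))\<^sup>2"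
      by (simp add: stereo_def Some norm_prod_def[of "(_, _)"] power_mult_distrib power_divide)
    also have "\<dots> = (4 * (norm p)\<^sup>2 + ((norm p)\<^sup>2 - 1)\<^sup>2) / (1 + (norm p)\<^sup>2)\<^sup>2"
      by (simp add: power_divide add_divide_distrib)
    also have "4 * (norm p)\<^sup>2 + ((norm p)\<^sup>2 - 1)\<^sup>2 = (1 + (norm p)\<^sup>2)\<^sup>2"
      by (simp add: power2_eq_square algebra_simps)
    finally show ?thesis
      using one_plus_norm_squared_pos[of p] by simp
  qed (simp add: stereo_def norm_prod_def)
  then show ?thesis by (simp add: power2_eq_1_iff)
       (metis norm_ge_zero not_one_le_zero neg_0_le_iff_le)
qed

text \<open>For unit vectors the squared chord is 2 minus twice the inner product; what remains is
  to compute that product for finite and infinite points.\<close>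

lemma dist_stereo: "dist (stereo x) (stereo y) = cdist x y"
proof -
  have sq: "(dist (stereo x) (stereo y))\<^sup>2 = 2 - 2 * (stereo x \<bullet> stereo y)"
    using norm_stereo[of x] norm_stereo[of y]
    by (simp add: dist_norm power2_norm_eq_inner inner_diff_left inner_diff_right inner_commute norm_eq_1)
  have "(dist (stereo x) (stereo y))\<^sup>2 = (cdist x y)\<^sup>2 \<and> cdist x y \<ge> 0"
  proof (cases x; cases y)
    fix p q assume xy: "x = Some p" "y = Some q"
    have "2 - 2 * (stereo x \<bullet> stereo y) = 4 * (norm (p - q))\<^sup>2 / ((1 + (norm p)\<^sup>2) * (1 + (norm q)\<^sup>2))"
    proof -
      have "(norm (p - q))\<^sup>2 = (norm p)\<^sup>2 - 2 * (p \<bullet> q) + (norm q)\<^sup>2"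
        by (simp add: power2_norm_eq_inner inner_diff_left inner_diff_right inner_commute)
      then show ?thesis
        using one_plus_norm_squared_pos[of p] one_plus_norm_squared_pos[of q]
        by (simp add: xy stereo_def divide_simps) (simp add: algebra_simps)
    qed
    then show ?thesis
      using one_plus_norm_squared_pos[of p] one_plus_norm_squared_pos[of q]
      unfolding sq by (simp add: xy cdist_Some power_divide power_mult_distrib)
  next
    fix p assume xy: "x = Some p" "y = None"
    show ?thesis
      unfolding sq using one_plus_norm_squared_pos[of p]
      by (simp add: xy stereo_def cdist_None power_divide divide_simps)
  next
    fix p assume xy: "x = None" "y = Some p"
    show ?thesis
      unfolding sq using one_plus_norm_squared_pos[of p]
      by (simp add: xy stereo_def cdist_None power_divide divide_simps)
  qed (simp add: sq stereo_def)
  then show ?thesis using power2_eq_iff_nonneg[OF zero_le_dist] by blast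
qed

lemma cdist_nonneg: "0 \<le> cdist x y"
  and cdist_commute: "cdist x y = cdist y x"
  and cdist_le_2: "cdist x y \<le> 2"
proof -
  show "0 \<le> cdist x y" "cdist x y = cdist y x"
    by (simp_all add: dist_commute flip: dist_stereo)
  show "cdist x y \<le> 2"
    using norm_triangle_ineq4[of "stereo x" "stereo y"]
    by (simp add: norm_stereo dist_norm flip: dist_stereo)
qed

lemma inj_stereo: "inj stereo"
proof (rule injI)
  fix x y assume "stereo x = stereo y"
  then have "cdist x y = 0" by (simp flip: dist_stereo)
  moreover have "1 + (norm p)\<^sup>2 \<noteq> 0" for p :: "complex \<times> real"
    using one_plus_norm_squared_pos[of p] by simp
  ultimately show "x = y"
    by (cases x; cases y) (auto simp: cdist_Some cdist_None)
qed

abbreviation stereo_in :: "H3 \<Rightarrow> (complex \<times> real) \<times> real" where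
  "stereo_in p \<equiv> stereo (emb (Inl p))"

abbreviation stereo_bd :: "Sph \<Rightarrow> (complex \<times> real) \<times> real" where
  "stereo_bd \<xi> \<equiv> stereo (emb (Inr \<xi>))"

lemma emb_simps:
  "emb (Inl p) = Some (pt p)" "emb (Inr None) = None" "emb (Inr (Some z)) = Some (z, 0)"
  by (simp_all add: emb_def)

lemma pt_pos: "snd (pt p) > 0"
  using pt[of p] by simp

text \<open>The height of the stereographic image of \<open>p\<close> is \<open>2 / height_weight p\<close>.\<close>

definition height_weight :: "H3 \<Rightarrow> real" where
  "height_weight p = (1 + (norm (pt p))\<^sup>2) / snd (pt p)"

lemma height_weight_pos: "height_weight p > 0"
  unfolding height_weight_def by (intro divide_pos_pos one_plus_norm_squared_pos pt_pos)

lemma height_weight_ge_2: "height_weight p \<ge> 2"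
proof -
  obtain z t where p: "pt p = (z, t)" by fastforce
  have "t > 0" using pt_pos[of p] p by simp
  have "2 * t \<le> 1 + (cmod z)\<^sup>2 + t\<^sup>2"
    using sum_squares_bound[of t 1] by (simp add: algebra_simps) (smt (verit) zero_le_power2)
  with \<open>t > 0\<close> show ?thesis by (simp add: height_weight_def p norm_pair_squared pos_le_divide_eq add.assoc)
qed

text \<open>Hyperbolic and chordal distance differ by a factor that splits as a product over the two
  points, hence cancels in cross ratios.\<close>

lemma cosh_hdist:
  "cosh (hdist p q) = 1 + (cdist (emb (Inl p)) (emb (Inl q)))\<^sup>2 * height_weight p * height_weight q / 8"
proof -
  let ?e = "((cmod (fst (pt p) - fst (pt q)))\<^sup>2 + (snd (pt p) - snd (pt q))\<^sup>2) / (2 * snd (pt p) * snd (pt q))"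
  have "?e \<ge> 0"
    using pt_pos[of p] pt_pos[of q] by simp
  then have "cosh (hdist p q) = 1 + ?e"
    unfolding hdist_def by (intro cosh_arcosh_real) simp
  moreover have "?e = (norm (pt p - pt q))\<^sup>2 / (2 * snd (pt p) * snd (pt q))"
    by (simp add: norm_prod_def)
  moreover have "\<dots> = (cdist (emb (Inl p)) (emb (Inl q)))\<^sup>2 * height_weight p * height_weight q / 8"
    using pt_pos[of p] pt_pos[of q] one_plus_norm_squared_pos[of "pt p"] one_plus_norm_squared_pos[of "pt q"]
    by (simp add: emb_simps cdist_Some height_weight_def power_divide power_mult_distrib divide_simps)
  ultimately show ?thesis by simp
qed

text \<open>Each square root of a weight belongs to a single point. In products of such identities
  the weights can therefore be collected point by point, which is how they cancel in cross
  ratios.\<close>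

lemma isometry_cdist:
  assumes "hyp_isometry G"
  shows "cdist (emb (Inl (G p))) (emb (Inl (G q))) * sqrt (height_weight (G p)) * sqrt (height_weight (G q))
       = cdist (emb (Inl p)) (emb (Inl q)) * sqrt (height_weight p) * sqrt (height_weight q)"
proof -
  have "cosh (hdist (G p) (G q)) = cosh (hdist p q)"
    using assms by (simp add: hyp_isometry_def)
  then have "(cdist (emb (Inl (G p))) (emb (Inl (G q))))\<^sup>2 * height_weight (G p) * height_weight (G q)
       = (cdist (emb (Inl p)) (emb (Inl q)))\<^sup>2 * height_weight p * height_weight q"
    by (simp add: cosh_hdist)
  then have "sqrt ((cdist (emb (Inl (G p))) (emb (Inl (G q))))\<^sup>2 * height_weight (G p) * height_weight (G q))
       = sqrt ((cdist (emb (Inl p)) (emb (Inl q)))\<^sup>2 * height_weight p * height_weight q)"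
    by (simp only:)
  then show ?thesis
    by (simp add: real_sqrt_mult cdist_nonneg)
qed

text \<open>Weights exist only at interior points, so boundary identities are obtained as limits of
  interior ones. The approach is along a vertical line: up to infinity, or down to
  \<open>z\<close>.\<close>

lemma boundary_approx:
  obtains p :: "nat \<Rightarrow> H3" where "(\<lambda>n. stereo_in (p n)) \<longlonglongrightarrow> stereo_bd \<xi>"
proof -
  have lim_dist: "(\<lambda>n. stereo_in (p n)) \<longlonglongrightarrow> stereo_bd \<xi>"
    if "(\<lambda>n. cdist (emb (Inl (p n))) (emb (Inr \<xi>))) \<longlonglongrightarrow> 0" for p
    using that by (simp add: tendsto_dist_iff[of _ "stereo_bd \<xi>"] dist_stereo)
  show thesis
  proof (cases \<xi>)
    case None
    define p where "p n = Abs_H3 (0, real (Suc n))" for n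
    have pt: "pt (p n) = (0, real (Suc n))" for n
      unfolding p_def by (rule Abs_H3_inverse) simp
    have "(\<lambda>n. cdist (emb (Inl (p n))) (emb (Inr \<xi>))) \<longlonglongrightarrow> 0"
    proof (rule tendsto_sandwich[where f = "\<lambda>_. 0"])
      show "\<forall>\<^sub>F n in sequentially. cdist (emb (Inl (p n))) (emb (Inr \<xi>)) \<le> 2 / real (Suc n)"
      proof (intro always_eventually allI)
        fix n
        have "real (Suc n) \<le> sqrt (1 + (real (Suc n))\<^sup>2)" by (rule real_le_rsqrt) simp
        then show "cdist (emb (Inl (p n))) (emb (Inr \<xi>)) \<le> 2 / real (Suc n)"
          by (simp add: emb_simps None pt cdist_None norm_pair_squared frac_le)
      qed
      have "(\<lambda>n. 2 * (1 / real (Suc n))) \<longlonglongrightarrow> 2 * 0"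
        by (intro tendsto_intros LIMSEQ_Suc[OF lim_1_over_n])
      then show "(\<lambda>n. 2 / real (Suc n)) \<longlonglongrightarrow> 0" by simp
    qed (auto simp: cdist_nonneg)
    then show ?thesis by (rule that[OF lim_dist])
  next
    case (Some z)
    define p where "p n = Abs_H3 (z, 1 / real (Suc n))" for n
    have pt: "pt (p n) = (z, 1 / real (Suc n))" for n
      unfolding p_def by (rule Abs_H3_inverse) simp
    have "(\<lambda>n. cdist (emb (Inl (p n))) (emb (Inr \<xi>))) \<longlonglongrightarrow> 0"
    proof (rule tendsto_sandwich[where f = "\<lambda>_. 0"])
      show "\<forall>\<^sub>F n in sequentially. cdist (emb (Inl (p n))) (emb (Inr \<xi>)) \<le> 2 * (1 / real (Suc n))"
      proof (intro always_eventually allI)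
        fix n
        let ?N = "(1 + (norm (pt (p n)))\<^sup>2) * (1 + (norm (z, 0::real))\<^sup>2)"
        have "1 * 1 \<le> ?N" by (intro mult_mono) auto
        then have "1 \<le> sqrt ?N" by simp
        moreover have "norm (pt (p n) - (z, 0)) = 1 / real (Suc n)" by (simp add: pt norm_prod_def)
        ultimately show "cdist (emb (Inl (p n))) (emb (Inr \<xi>)) \<le> 2 * (1 / real (Suc n))"
          using frac_le[of "2 * (1 / real (Suc n))" "2 * (1 / real (Suc n))" 1 "sqrt ?N"]
          by (simp add: emb_simps Some cdist_Some)
      qed
      have "(\<lambda>n. 2 * (1 / real (Suc n))) \<longlonglongrightarrow> 2 * 0"
        by (intro tendsto_intros LIMSEQ_Suc[OF lim_1_over_n])
      then show "(\<lambda>n. 2 * (1 / real (Suc n))) \<longlonglongrightarrow> 0" by simp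
    qed (auto simp: cdist_nonneg)
    then show ?thesis by (rule that[OF lim_dist])
  qed
qed

lemma cont_bar_tendsto:
  assumes "cont_bar (union_map G g)" "(\<lambda>n. stereo_in (p n)) \<longlonglongrightarrow> stereo_bd \<xi>"
  shows "(\<lambda>n. stereo_in (G (p n))) \<longlonglongrightarrow> stereo_bd (g \<xi>)"
  unfolding tendsto_iff dist_stereo
proof (intro allI impI)
  fix e :: real assume "e > 0"
  then obtain d where d: "d > 0" "\<And>y. cdist (emb y) (emb (Inr \<xi>)) < d
      \<Longrightarrow> cdist (emb (union_map G g y)) (emb (union_map G g (Inr \<xi>))) < e"
    using assms(1) unfolding cont_bar_def by blast
  have "\<forall>\<^sub>F n in sequentially. cdist (emb (Inl (p n))) (emb (Inr \<xi>)) < d"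
    using tendstoD[OF assms(2) d(1)] by (simp add: dist_stereo)
  then show "\<forall>\<^sub>F n in sequentially. cdist (emb (Inl (G (p n)))) (emb (Inr (g \<xi>))) < e"
    by eventually_elim (use d(2) in \<open>force simp: union_map_def\<close>)
qed

abbreviation bdist :: "Sph \<Rightarrow> Sph \<Rightarrow> real" where
  "bdist \<xi> \<eta> \<equiv> cdist (emb (Inr \<xi>)) (emb (Inr \<eta>))"

text \<open>Each of the four points occurs once in the pairing ab, cd and once in the pairing ac,
  bd, so the weights cancel at interior points; the boundary case is the limit. Cross-multiplying
  keeps the identity meaningful when points coincide.\<close>

lemma Isom_cross_ratio:
  assumes "(G, g) \<in> Isom"
  shows "bdist (g a) (g b) * bdist (g c) (g d) * (bdist a c * bdist b d)
       = bdist a b * bdist c d * (bdist (g a) (g c) * bdist (g b) (g d))"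
proof -
  have G: "hyp_isometry G" "cont_bar (union_map G g)" using assms by (auto simp: Isom_def)
  obtain A B C D where lim:
    "(\<lambda>n. stereo_in (A n)) \<longlonglongrightarrow> stereo_bd a" "(\<lambda>n. stereo_in (B n)) \<longlonglongrightarrow> stereo_bd b"
    "(\<lambda>n. stereo_in (C n)) \<longlonglongrightarrow> stereo_bd c" "(\<lambda>n. stereo_in (D n)) \<longlonglongrightarrow> stereo_bd d"
    using boundary_approx by metis
  note limG = lim[THEN cont_bar_tendsto[OF G(2)]]
  define e where "e p q = cdist (emb (Inl p)) (emb (Inl q))" for p q
  define w where "w p = sqrt (height_weight p)" for p
  have w: "w p > 0" for p using height_weight_pos by (simp add: w_def)
  have iso: "e (G p) (G q) * w (G p) * w (G q) = e p q * w p * w q" for p q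
    unfolding e_def w_def by (rule isometry_cdist[OF G(1)])
  have eq: "e (G a) (G b) * e (G c) (G d) * (e a c * e b d) = e a b * e c d * (e (G a) (G c) * e (G b) (G d))"
    (is "?l = ?r") for a b c d
  proof -
    let ?w = "w a * w b * w c * w d * (w (G a) * w (G b) * w (G c) * w (G d))"
    have "?l * ?w = (e (G a) (G b) * w (G a) * w (G b)) * (e (G c) (G d) * w (G c) * w (G d))
        * ((e a c * w a * w c) * (e b d * w b * w d))" by (simp only: mult_ac)
    also have "\<dots> = (e a b * w a * w b) * (e c d * w c * w d)
        * ((e (G a) (G c) * w (G a) * w (G c)) * (e (G b) (G d) * w (G b) * w (G d)))"
      by (simp only: iso)
    also have "\<dots> = ?r * ?w" by (simp only: mult_ac)
    finally show ?thesis using w by (simp add: less_imp_neq[symmetric])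
  qed
  have "(\<lambda>n. e (G (A n)) (G (B n)) * e (G (C n)) (G (D n)) * (e (A n) (C n) * e (B n) (D n)))
      \<longlonglongrightarrow> bdist (g a) (g b) * bdist (g c) (g d) * (bdist a c * bdist b d)"
    unfolding e_def dist_stereo[symmetric] by (intro tendsto_intros lim limG)
  moreover have "(\<lambda>n. e (A n) (B n) * e (C n) (D n) * (e (G (A n)) (G (C n)) * e (G (B n)) (G (D n))))
      \<longlonglongrightarrow> bdist a b * bdist c d * (bdist (g a) (g c) * bdist (g b) (g d))"
    unfolding e_def dist_stereo[symmetric] by (intro tendsto_intros lim limG)
  ultimately show ?thesis
    unfolding eq by (rule LIMSEQ_unique)
qed

text \<open>The quotient \<open>bdist \<xi> \<eta> / (cdist p \<xi> * cdist p \<eta> * height_weight p)\<close> is, up to a constant,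
  the visual distance of \<open>\<xi>\<close> and \<open>\<eta>\<close> seen from \<open>p\<close>.\<close>

lemma Isom_visual:
  assumes "(G, g) \<in> Isom"
  shows "bdist (g \<xi>) (g \<eta>) * (cdist (emb (Inl p)) (emb (Inr \<xi>)) * cdist (emb (Inl p)) (emb (Inr \<eta>)) * height_weight p)
    = bdist \<xi> \<eta> * (cdist (emb (Inl (G p))) (emb (Inr (g \<xi>))) * cdist (emb (Inl (G p))) (emb (Inr (g \<eta>)))
        * height_weight (G p))"
proof -
  have G: "hyp_isometry G" "cont_bar (union_map G g)" using assms by (auto simp: Isom_def)
  obtain A B where lim:
    "(\<lambda>n. stereo_in (A n)) \<longlonglongrightarrow> stereo_bd \<xi>" "(\<lambda>n. stereo_in (B n)) \<longlonglongrightarrow> stereo_bd \<eta>"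
    using boundary_approx by metis
  note limG = lim[THEN cont_bar_tendsto[OF G(2)]]
  define e where "e p q = cdist (emb (Inl p)) (emb (Inl q))" for p q
  define w where "w p = sqrt (height_weight p)" for p
  have w: "w p > 0" for p using height_weight_pos by (simp add: w_def)
  have ww: "height_weight p = w p * w p" for p
    using height_weight_pos[of p] by (simp add: w_def)
  have iso: "e (G p) (G q) * w (G p) * w (G q) = e p q * w p * w q" for p q
    unfolding e_def w_def by (rule isometry_cdist[OF G(1)])
  have eq: "e (G a) (G b) * (e p a * e p b * height_weight p)
      = e a b * (e (G p) (G a) * e (G p) (G b) * height_weight (G p))" (is "?l = ?r") for a b
  proof -
    \<comment> \<open>Only the weights of \<open>a\<close>, \<open>b\<close> and their images are
      cancelled; the two square roots at \<open>p\<close> combine into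
      \<open>height_weight p\<close>.\<close>
    let ?w = "w a * w b * (w (G a) * w (G b))"
    have "?l * ?w = (e (G a) (G b) * w (G a) * w (G b)) * ((e p a * w p * w a) * (e p b * w p * w b))"
      unfolding ww by (simp only: mult_ac)
    also have "\<dots> = (e a b * w a * w b)
        * ((e (G p) (G a) * w (G p) * w (G a)) * (e (G p) (G b) * w (G p) * w (G b)))"
      by (simp only: iso)
    also have "\<dots> = ?r * ?w" unfolding ww by (simp only: mult_ac)
    finally show ?thesis using w by (simp add: less_imp_neq[symmetric])
  qed
  have "(\<lambda>n. e (G (A n)) (G (B n)) * (e p (A n) * e p (B n) * height_weight p))
      \<longlonglongrightarrow> bdist (g \<xi>) (g \<eta>) * (cdist (emb (Inl p)) (emb (Inr \<xi>)) * cdist (emb (Inl p)) (emb (Inr \<eta>)) * height_weight p)"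
    unfolding e_def dist_stereo[symmetric] by (intro tendsto_intros lim limG)
  moreover have "(\<lambda>n. e (A n) (B n) * (e (G p) (G (A n)) * e (G p) (G (B n)) * height_weight (G p)))
      \<longlonglongrightarrow> bdist \<xi> \<eta> * (cdist (emb (Inl (G p))) (emb (Inr (g \<xi>))) * cdist (emb (Inl (G p))) (emb (Inr (g \<eta>)))
        * height_weight (G p))"
    unfolding e_def dist_stereo[symmetric] by (intro tendsto_intros lim limG)
  ultimately show ?thesis
    unfolding eq by (rule LIMSEQ_unique)
qed

section \<open>Weak quasisymmetry of the boundary map\<close>

lemma stereo_bd_Some:
  "stereo_bd (Some z) = (((2 / (1 + (cmod z)\<^sup>2)) *\<^sub>R z, 0), ((cmod z)\<^sup>2 - 1) / (1 + (cmod z)\<^sup>2))"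
  by (simp add: emb_simps stereo_def norm_pair_squared)

lemma stereo_bd_None: "stereo_bd None = (0, 1)"
  by (simp add: emb_simps stereo_def)

lemma inj_stereo_bd: "inj stereo_bd"
proof (rule injI)
  fix \<xi> \<eta> assume "stereo_bd \<xi> = stereo_bd \<eta>"
  then have "emb (Inr \<xi>) = emb (Inr \<eta>)" by (rule injD[OF inj_stereo])
  then show "\<xi> = \<eta>" by (cases \<xi>; cases \<eta>) (auto simp: emb_simps)
qed

text \<open>The image is the 2-sphere cut out of the unit 3-sphere by the hyperplane on which the
  height coordinate vanishes.\<close>

lemma compact_range_stereo_bd: "compact (range stereo_bd)"
proof -
  have "range stereo_bd = sphere 0 1 \<inter> {x. snd (fst x) = 0}"
  proof (intro equalityI subsetI)
    fix x assume "x \<in> range stereo_bd"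
    then obtain \<xi> where "x = stereo_bd \<xi>" by blast
    then show "x \<in> sphere 0 1 \<inter> {x. snd (fst x) = 0}"
      by (cases \<xi>) (use norm_stereo[of "emb (Inr \<xi>)"] in \<open>auto simp: emb_simps stereo_def\<close>)
  next
    fix x :: "(complex \<times> real) \<times> real" assume x: "x \<in> sphere 0 1 \<inter> {x. snd (fst x) = 0}"
    then obtain z u where zu: "x = ((z, 0), u)"
      by (metis IntD2 mem_Collect_eq prod.collapse)
    have "(norm x)\<^sup>2 = 1" using x by simp
    then have n: "(cmod z)\<^sup>2 + u\<^sup>2 = 1" by (simp add: zu norm_prod_def)
    show "x \<in> range stereo_bd"
    proof (cases "u = 1")
      case True
      then have "x = stereo_bd None" using n by (simp add: stereo_bd_None zu zero_prod_def)
      then show ?thesis by blast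
    next
      case False
      \<comment> \<open>The stereographic projection of \<open>x\<close> from the pole, finite
        because \<open>u \<noteq> 1\<close>.\<close>
      define w where "w = z /\<^sub>R (1 - u)"
      have "(cmod w)\<^sup>2 = (1 - u\<^sup>2) / (1 - u)\<^sup>2"
        using n by (simp add: w_def power_mult_distrib power_inverse divide_inverse)
      also have "1 - u\<^sup>2 = (1 + u) * (1 - u)" by (simp add: power2_eq_square algebra_simps)
      finally have w: "(cmod w)\<^sup>2 = (1 + u) / (1 - u)"
        using False by (simp add: power2_eq_square)
      have "1 + (cmod w)\<^sup>2 = 2 / (1 - u)" "(cmod w)\<^sup>2 - 1 = 2 * u / (1 - u)"
        unfolding w using False by (simp_all add: field_simps)
      then have "2 / (1 + (cmod w)\<^sup>2) = 1 - u" "((cmod w)\<^sup>2 - 1) / (1 + (cmod w)\<^sup>2) = u"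
        using False by simp_all
      moreover have "(1 - u) *\<^sub>R w = z" using False by (simp add: w_def)
      ultimately have "stereo_bd (Some w) = x"
        unfolding stereo_bd_Some zu by simp
      then show ?thesis by blast
    qed
  qed
  moreover have "closed {x :: (complex \<times> real) \<times> real. snd (fst x) = 0}"
    by (intro closed_Collect_eq continuous_intros)
  ultimately show ?thesis by (simp add: compact_Int_closed)
qed

lemma cont_S_continuous_on:
  assumes "cont_S g"
  shows "continuous_on (range stereo_bd) (\<lambda>x. stereo_bd (g (inv stereo_bd x)))"
  unfolding continuous_on_iff
proof (intro ballI allI impI)
  fix x and e :: real assume "x \<in> range stereo_bd" "e > 0"
  then obtain \<xi> where \<xi>: "x = stereo_bd \<xi>" by blast
  obtain d where d: "d > 0" "\<And>\<eta>. bdist \<eta> \<xi> < d \<Longrightarrow> bdist (g \<eta>) (g \<xi>) < e"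
    using assms \<open>e > 0\<close> unfolding cont_S_def by blast
  show "\<exists>d>0. \<forall>x'\<in>range stereo_bd. dist x' x < d
      \<longrightarrow> dist (stereo_bd (g (inv stereo_bd x'))) (stereo_bd (g (inv stereo_bd x))) < e"
    using d by (auto simp: \<xi> dist_stereo inv_f_f[OF inj_stereo_bd])
qed

text \<open>This is uniform continuity of the inverse of \<open>h\<close> on the compact sphere,
  read contrapositively.\<close>

lemma homeo_S_separation:
  assumes "homeo_S h" "\<delta> > 0"
  obtains \<delta>' where "\<delta>' > 0" "\<And>\<xi> \<eta>. bdist \<xi> \<eta> \<ge> \<delta> \<Longrightarrow> bdist (h \<xi>) (h \<eta>) \<ge> \<delta>'"
proof -
  have h: "bij h" "cont_S (inv h)" using assms by (auto simp: homeo_S_def)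
  let ?F = "\<lambda>x. stereo_bd (inv h (inv stereo_bd x))"
  have "uniformly_continuous_on (range stereo_bd) ?F"
    by (intro compact_uniformly_continuous cont_S_continuous_on h compact_range_stereo_bd)
  then obtain d where d: "d > 0"
    "\<And>x y. \<lbrakk>x \<in> range stereo_bd; y \<in> range stereo_bd; dist y x < d\<rbrakk> \<Longrightarrow> dist (?F y) (?F x) < \<delta>"
    using \<open>\<delta> > 0\<close> unfolding uniformly_continuous_on_def by metis
  show thesis
  proof (rule that[OF d(1)], rule ccontr)
    fix \<xi> \<eta> assume "bdist \<xi> \<eta> \<ge> \<delta>" "\<not> bdist (h \<xi>) (h \<eta>) \<ge> d"
    then show False
      using d(2)[of "stereo_bd (h \<eta>)" "stereo_bd (h \<xi>)"] h(1)
      by (simp add: dist_stereo inv_f_f[OF inj_stereo_bd] bij_is_inj)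
  qed
qed

text \<open>Away from the pole a point of the plane is recovered from its image on the sphere by a
  continuous formula, so chordal continuity becomes Euclidean continuity.\<close>

lemma cont_S_continuous_on_plane:
  assumes "cont_S g" "\<And>z. g (Some z) = Some (f z)"
  shows "continuous_on UNIV f"
proof -
  have nz: "1 + (cmod z)\<^sup>2 \<noteq> 0" for z
    using one_plus_norm_squared_pos[of z] by simp
  have "continuous_on UNIV (\<lambda>z. stereo_bd (Some z))"
    unfolding stereo_bd_Some by (intro continuous_intros) (use nz in auto)
  then have "continuous_on UNIV (\<lambda>z. stereo_bd (g (inv stereo_bd (stereo_bd (Some z)))))"
    by (rule continuous_on_compose2[OF cont_S_continuous_on[OF assms(1)]]) auto
  then have cont: "continuous_on UNIV (\<lambda>z. stereo_bd (Some (f z)))"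
    by (simp add: inv_f_f[OF inj_stereo_bd] assms(2))
  have one_minus: "1 - snd (stereo_bd (Some w)) = 2 / (1 + (cmod w)\<^sup>2)" for w
    unfolding stereo_bd_Some using nz[of w] by (simp add: field_simps)
  have inverse: "fst (fst (stereo_bd (Some w))) /\<^sub>R (1 - snd (stereo_bd (Some w))) = w" for w
  proof -
    have "fst (fst (stereo_bd (Some w))) = (2 / (1 + (cmod w)\<^sup>2)) *\<^sub>R w"
      by (simp add: stereo_bd_Some)
    moreover have "inverse (2 / (1 + (cmod w)\<^sup>2)) * (2 / (1 + (cmod w)\<^sup>2)) = 1"
      using nz[of w] by (intro left_inverse) simp
    ultimately show ?thesis
      unfolding one_minus by (simp only: scaleR_scaleR scaleR_one)
  qed
  have "continuous_on UNIV (\<lambda>z. fst (fst (stereo_bd (Some (f z)))) /\<^sub>R (1 - snd (stereo_bd (Some (f z)))))"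
    by (intro continuous_intros cont) (use one_minus nz in auto)
  then show ?thesis unfolding inverse .
qed

section \<open>Visual distance from interior points, and cocompactness\<close>

lemma cdist_boundary_ge: "2 / height_weight p \<le> cdist (emb (Inl p)) (emb (Inr \<xi>))"
proof -
  have "snd (fst (stereo_in p)) = 2 / height_weight p"
    by (simp add: emb_simps stereo_def height_weight_def)
  moreover have "snd (fst (stereo_bd \<xi>)) = 0"
    by (cases \<xi>) (auto simp: emb_simps stereo_def)
  \<comment> \<open>The height coordinate is 1-Lipschitz, and it separates the interior point from
    the boundary sphere, where it vanishes.\<close>
  moreover have "dist (snd (fst (stereo_in p))) (snd (fst (stereo_bd \<xi>))) \<le> dist (stereo_in p) (stereo_bd \<xi>)"
    by (meson dist_fst_le dist_snd_le order_trans)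
  ultimately show ?thesis
    using height_weight_pos[of p] by (simp add: dist_real_def dist_stereo)
qed

lemma height_weight_bounded_on_compact:
  assumes "compact (pt ` K)"
  obtains B where "B > 0" "\<And>k. k \<in> K \<Longrightarrow> height_weight k \<le> B"
proof -
  have "continuous_on (pt ` K) (\<lambda>x. (1 + (norm x)\<^sup>2) / snd x)"
    by (intro continuous_intros) (use pt_pos in \<open>auto simp: less_imp_neq[symmetric]\<close>)
  then have "bounded ((\<lambda>x. (1 + (norm x)\<^sup>2) / snd x) ` pt ` K)"
    by (intro compact_imp_bounded compact_continuous_image assms)
  then obtain B where B: "B > 0" "\<And>y. y \<in> (\<lambda>x. (1 + (norm x)\<^sup>2) / snd x) ` pt ` K \<Longrightarrow> norm y \<le> B"
    unfolding bounded_pos by blast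
  have "height_weight k \<le> B" if "k \<in> K" for k
    using B(2)[of "height_weight k"] that pt_pos[of k] by (auto simp: height_weight_def)
  with B(1) show thesis by (rule that)
qed

text \<open>Cocompactness: every point of hyperbolic space can be moved into a fixed compact set, and
  there boundary points that look far apart are far apart for the chordal metric.\<close>

lemma nice_lattice_separation:
  assumes "nice_lattice \<Gamma>"
  obtains \<delta> where "\<delta> > 0" "\<forall>p. \<exists>G g g'. (G, g) \<in> \<Gamma> \<and> (\<forall>\<xi>. g (g' \<xi>) = \<xi>) \<and>
    (\<forall>\<xi> \<eta>. cdist (emb (Inl p)) (emb (Inr \<xi>)) * cdist (emb (Inl p)) (emb (Inr \<eta>)) * height_weight p
              \<le> 4 * bdist \<xi> \<eta> \<longrightarrow> \<delta> \<le> bdist (g' \<xi>) (g' \<eta>))"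
proof -
  have \<Gamma>: "\<Gamma> \<subseteq> Isom" and comp: "\<forall>(G1, g1)\<in>\<Gamma>. \<forall>(G2, g2)\<in>\<Gamma>. (G1 \<circ> G2, g1 \<circ> g2) \<in> \<Gamma>"
    and inv: "\<forall>(G, g)\<in>\<Gamma>. (inv G, inv g) \<in> \<Gamma>" and free: "\<forall>(G, g)\<in>\<Gamma>. (\<exists>p. G p = p) \<longrightarrow> (G, g) = (id, id)"
    and "\<exists>K. compact (pt ` K) \<and> (\<Union>\<gamma>\<in>\<Gamma>. fst \<gamma> ` K) = UNIV"
    using assms unfolding nice_lattice_def by blast+
  then obtain K where K: "compact (pt ` K)" "(\<Union>\<gamma>\<in>\<Gamma>. fst \<gamma> ` K) = UNIV" by blast
  obtain B where B: "B > 0" "\<And>k. k \<in> K \<Longrightarrow> height_weight k \<le> B"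
    using height_weight_bounded_on_compact[OF K(1)] by blast
  show thesis
  \<comment> \<open>At a point of \<open>K\<close> both distances to the boundary are at least
    \<open>2 / B\<close> and the weight is at least 2, with product at least
    \<open>8 / B\<^sup>2\<close>. The factor 4 in the hypothesis leaves a quarter of this.\<close>
  proof (rule that[of "2 / B\<^sup>2"], goal_cases)
    case 1
    then show ?case using B(1) by simp
  next
    case 2
    show ?case
    proof
      fix p
      have "p \<in> (\<Union>\<gamma>\<in>\<Gamma>. fst \<gamma> ` K)" using K(2) by simp
      then obtain G g k where Gg: "(G, g) \<in> \<Gamma>" "k \<in> K" "p = G k" by fastforce
      have bij: "bij G" using Gg(1) \<Gamma> by (auto simp: Isom_def hyp_isometry_def)
      have inv_mem: "(inv G, inv g) \<in> \<Gamma>" using inv Gg(1) by blast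
      then have "(G \<circ> inv G, g \<circ> inv g) \<in> \<Gamma>" using comp Gg(1) by blast
      \<comment> \<open>Membership in \<open>Isom\<close> does not by itself say that the boundary
        map is bijective. Freeness supplies the right inverse: the product element fixes
        \<open>p\<close>, hence is the identity pair, boundary map included.\<close>
      moreover have "(G \<circ> inv G) p = p" using bij by (simp add: bij_is_surj surj_f_inv_f)
      ultimately have "g \<circ> inv g = id" using free by blast
      then have right_inv: "g (inv g \<xi>) = \<xi>" for \<xi> by (metis comp_apply id_apply)
      have Gp: "inv G p = k" using bij Gg(3) by (simp add: bij_is_inj)
      have "2 / B\<^sup>2 \<le> bdist (inv g \<xi>) (inv g \<eta>)"
        if le: "cdist (emb (Inl p)) (emb (Inr \<xi>)) * cdist (emb (Inl p)) (emb (Inr \<eta>)) * height_weight p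
            \<le> 4 * bdist \<xi> \<eta>" (is "?X \<le> _") for \<xi> \<eta>
      proof -
        have "0 < cdist (emb (Inl p)) (emb (Inr \<zeta>))" for \<zeta>
          using cdist_boundary_ge[of p \<zeta>] height_weight_pos[of p]
          by (meson divide_pos_pos less_le_trans zero_less_numeral)
        \<comment> \<open>The hypothesis forces the two boundary points apart, so
          \<open>bdist \<xi> \<eta>\<close> can be cancelled at the end.\<close>
        then have "0 < ?X" using height_weight_pos[of p] by (intro mult_pos_pos) auto
        then have pos: "0 < bdist \<xi> \<eta>" using le by linarith
        have ge: "2 / B \<le> cdist (emb (Inl k)) (emb (Inr \<zeta>))" for \<zeta>
        proof -
          have "2 / B \<le> 2 / height_weight k"
            using B(2)[OF Gg(2)] height_weight_pos[of k] by (intro frac_le) auto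
          then show ?thesis using cdist_boundary_ge[of k \<zeta>] by linarith
        qed
        have "bdist \<xi> \<eta> * (2 / B * (2 / B) * 2)
            \<le> bdist \<xi> \<eta> * (cdist (emb (Inl k)) (emb (Inr (inv g \<xi>))) * cdist (emb (Inl k)) (emb (Inr (inv g \<eta>)))
                * height_weight k)"
          using B(1) by (intro mult_left_mono mult_mono ge height_weight_ge_2)
            (auto simp: cdist_nonneg)
        also have "\<dots> = bdist (inv g \<xi>) (inv g \<eta>) * ?X"
          using Isom_visual[of "inv G" "inv g" \<xi> \<eta> p] inv_mem \<Gamma> by (auto simp: Gp)
        also have "\<dots> \<le> bdist (inv g \<xi>) (inv g \<eta>) * (4 * bdist \<xi> \<eta>)"
          by (intro mult_left_mono le cdist_nonneg)
        finally have "bdist \<xi> \<eta> * (8 / B\<^sup>2) \<le> bdist \<xi> \<eta> * (4 * bdist (inv g \<xi>) (inv g \<eta>))"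
          by (simp add: power2_eq_square mult_ac)
        then have "8 / B\<^sup>2 \<le> 4 * bdist (inv g \<xi>) (inv g \<eta>)"
          using pos by (rule mult_left_le_imp_le)
        then show ?thesis by simp
      qed
      then show "\<exists>G g g'. (G, g) \<in> \<Gamma> \<and> (\<forall>\<xi>. g (g' \<xi>) = \<xi>) \<and>
        (\<forall>\<xi> \<eta>. cdist (emb (Inl p)) (emb (Inr \<xi>)) * cdist (emb (Inl p)) (emb (Inr \<eta>)) * height_weight p
              \<le> 4 * bdist \<xi> \<eta> \<longrightarrow> 2 / B\<^sup>2 \<le> bdist (g' \<xi>) (g' \<eta>))"
        using Gg(1) right_inv by blast
    qed
  qed
qed

text \<open>The norm factors cancel, and both parts reduce to this: \<open>p\<close>, at height
  \<open>r\<close> over \<open>z\<close>, is within Euclidean distance \<open>2 * r\<close> of every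
  boundary point that is within \<open>r\<close> of \<open>z\<close>. Seen from \<open>p\<close>,
  the pairs \<open>a\<close>, infinity and \<open>b\<close>, \<open>z\<close> are thus far enough
  apart for \<open>nice_lattice_separation\<close>.\<close>

lemma visual_bounds:
  fixes z a b :: complex
  assumes "r > 0" "pt p = (z, r)"
  shows "cmod (a - z) \<le> r \<Longrightarrow> cdist (emb (Inl p)) (emb (Inr (Some a))) * cdist (emb (Inl p)) (emb (Inr None))
          * height_weight p \<le> 4 * bdist (Some a) None"
    and "cmod (b - z) = r \<Longrightarrow> cdist (emb (Inl p)) (emb (Inr (Some b))) * cdist (emb (Inl p)) (emb (Inr (Some z)))
          * height_weight p \<le> 4 * bdist (Some b) (Some z)"
proof -
  define N where "N x = sqrt (1 + (norm x)\<^sup>2)" for x :: "complex \<times> real"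
  have N: "N x > 0" for x using one_plus_norm_squared_pos[of x] by (simp add: N_def)
  have W: "height_weight p = N (pt p) * N (pt p) / r"
    using one_plus_norm_squared_pos[of "pt p"] by (simp add: height_weight_def N_def assms(2))
  have dist_le: "norm (pt p - (c, 0)) \<le> 2 * r" if "cmod (c - z) \<le> r" for c
  proof -
    have "norm (z - c, r) \<le> norm (z - c) + norm r" by (rule norm_Pair_le)
    then show ?thesis using that assms by (simp add: norm_minus_commute)
  qed
  have c: "cdist (Some x) (Some y) = 2 * norm (x - y) / (N x * N y)" "cdist (Some x) None = 2 / N x" for x y
    by (simp_all add: cdist_Some cdist_None real_sqrt_mult N_def)
  {
    assume a: "cmod (a - z) \<le> r"
    have "cdist (emb (Inl p)) (emb (Inr (Some a))) * cdist (emb (Inl p)) (emb (Inr None)) * height_weight p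
      = 4 * norm (pt p - (a, 0)) / (r * N (a, 0))"
      using N[of "pt p"] N[of "(a, 0)"] assms(1) by (simp add: emb_simps c W)
    also have "\<dots> \<le> 4 * (2 * r) / (r * N (a, 0))"
      using N[of "(a, 0)"] assms(1) by (intro divide_right_mono mult_left_mono dist_le a) auto
    also have "\<dots> = 4 * bdist (Some a) None"
      using N[of "(a, 0)"] assms(1) by (simp add: emb_simps c)
    finally show "cdist (emb (Inl p)) (emb (Inr (Some a))) * cdist (emb (Inl p)) (emb (Inr None))
          * height_weight p \<le> 4 * bdist (Some a) None" .
  }
  {
    assume b: "cmod (b - z) = r"
    have "norm (pt p - (z, 0)) = r" using assms by (simp add: norm_prod_def)
    then have "cdist (emb (Inl p)) (emb (Inr (Some b))) * cdist (emb (Inl p)) (emb (Inr (Some z))) * height_weight p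
      = 4 * norm (pt p - (b, 0)) / (N (b, 0) * N (z, 0))"
      using N[of "pt p"] N[of "(b, 0)"] N[of "(z, 0)"] assms(1) by (simp add: emb_simps c W)
    also have "\<dots> \<le> 4 * (2 * r) / (N (b, 0) * N (z, 0))"
      using N[of "(b, 0)"] N[of "(z, 0)"] b by (intro divide_right_mono mult_left_mono dist_le) auto
    also have "\<dots> = 4 * bdist (Some b) (Some z)"
      using b assms(1) by (simp add: emb_simps c norm_prod_def)
    finally show "cdist (emb (Inl p)) (emb (Inr (Some b))) * cdist (emb (Inl p)) (emb (Inr (Some z)))
          * height_weight p \<le> 4 * bdist (Some b) (Some z)" .
  }
qed

text \<open>With infinity fixed, the chordal cross ratio of \<open>f a\<close>, \<open>f z\<close>,
  infinity and \<open>f b\<close> is the ratio of \<open>cmod (f a - f z)\<close> to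
  \<open>cmod (f b - f z)\<close>. An element of the second lattice computes it from four points
  whose two denominator pairs are uniformly separated.\<close>

lemma equivariant_pair_weakly_quasisymmetric:
  assumes pair: "equivariant_pair H h \<Gamma>1 \<Gamma>2" and f: "\<And>z. h (Some z) = Some (f z)" and "h None = None"
  obtains K where "K > 0"
    "\<And>z a b. cmod (a - z) \<le> cmod (b - z) \<Longrightarrow> cmod (f a - f z) \<le> K * cmod (f b - f z)"
proof -
  have h: "homeo_S h" and \<Gamma>: "nice_lattice \<Gamma>1" "nice_lattice \<Gamma>2"
    and conj: "(\<lambda>\<gamma>. h \<circ> snd \<gamma> \<circ> inv h) ` \<Gamma>1 = snd ` \<Gamma>2"
    using pair by (auto simp: equivariant_pair_def)
  obtain \<delta> where \<delta>: "\<delta> > 0" "\<forall>p. \<exists>G g g'. (G, g) \<in> \<Gamma>1 \<and> (\<forall>\<xi>. g (g' \<xi>) = \<xi>) \<and>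
    (\<forall>\<xi> \<eta>. cdist (emb (Inl p)) (emb (Inr \<xi>)) * cdist (emb (Inl p)) (emb (Inr \<eta>)) * height_weight p
              \<le> 4 * bdist \<xi> \<eta> \<longrightarrow> \<delta> \<le> bdist (g' \<xi>) (g' \<eta>))"
    by (rule nice_lattice_separation[OF \<Gamma>(1)]) (rule that)
  obtain \<delta>' where \<delta>': "\<delta>' > 0" "\<And>\<xi> \<eta>. bdist \<xi> \<eta> \<ge> \<delta> \<Longrightarrow> bdist (h \<xi>) (h \<eta>) \<ge> \<delta>'"
    using homeo_S_separation[OF h \<delta>(1)] by blast
  \<comment> \<open>The constant comes from two chordal distances that are at most 2, over two that
    are at least \<open>\<delta>'\<close>. If \<open>b = z\<close> then also
    \<open>a = z\<close>.\<close>
  have "cmod (f a - f z) \<le> 4 / \<delta>'\<^sup>2 * cmod (f b - f z)" if le: "cmod (a - z) \<le> cmod (b - z)" for z a b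
  proof (cases "b = z")
    case False
    define r where "r = cmod (b - z)"
    have "r > 0" using False by (simp add: r_def)
    define p where "p = Abs_H3 (z, r)"
    have p: "pt p = (z, r)"
      unfolding p_def by (rule Abs_H3_inverse) (simp add: \<open>r > 0\<close>)
    obtain G g g' where g: "(G, g) \<in> \<Gamma>1" "\<And>\<xi>. g (g' \<xi>) = \<xi>"
      "\<And>\<xi> \<eta>. cdist (emb (Inl p)) (emb (Inr \<xi>)) * cdist (emb (Inl p)) (emb (Inr \<eta>)) * height_weight p
              \<le> 4 * bdist \<xi> \<eta> \<Longrightarrow> \<delta> \<le> bdist (g' \<xi>) (g' \<eta>)"
      using \<delta>(2) by metis
    define k where "k \<xi> = h (g' \<xi>)" for \<xi>
    have "h \<circ> g \<circ> inv h \<in> snd ` \<Gamma>2"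
      using g(1) unfolding conj[symmetric] by force
    then obtain G2 where G2: "(G2, h \<circ> g \<circ> inv h) \<in> \<Gamma>2" by force
    \<comment> \<open>The conjugate of \<open>g\<close> by \<open>h\<close> acts through the second
      lattice and takes each \<open>k \<xi>\<close> to \<open>h \<xi>\<close>, so both quadruples
      have the same cross ratio.\<close>
    have hk: "(h \<circ> g \<circ> inv h) (k \<xi>) = h \<xi>" for \<xi>
      using h g(2) by (simp add: k_def homeo_S_def bij_is_inj)
    have "(G2, h \<circ> g \<circ> inv h) \<in> Isom" using G2 \<Gamma>(2) by (auto simp: nice_lattice_def)
    from Isom_cross_ratio[OF this, of "k (Some a)" "k (Some z)" "k None" "k (Some b)"]
    have cr: "bdist (h (Some a)) (h (Some z)) * bdist (h None) (h (Some b)) * (bdist (k (Some a)) (k None) * bdist (k (Some z)) (k (Some b)))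
       = bdist (k (Some a)) (k (Some z)) * bdist (k None) (k (Some b)) * (bdist (h (Some a)) (h None) * bdist (h (Some z)) (h (Some b)))"
      unfolding hk .
    have sep: "\<delta>' \<le> bdist (k (Some a)) (k None)" "\<delta>' \<le> bdist (k (Some b)) (k (Some z))"
      unfolding k_def using visual_bounds[OF \<open>r > 0\<close> p] le by (auto intro!: \<delta>'(2) g(3) simp: r_def)
    have "bdist (h (Some a)) (h (Some z)) * bdist (h None) (h (Some b)) * (\<delta>' * \<delta>')
      \<le> bdist (h (Some a)) (h (Some z)) * bdist (h None) (h (Some b)) * (bdist (k (Some a)) (k None) * bdist (k (Some z)) (k (Some b)))"
      using sep \<delta>'(1) by (intro mult_left_mono mult_mono) (auto simp: cdist_nonneg cdist_commute[of "emb (Inr (k (Some z)))"])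
    also have "\<dots> \<le> 2 * 2 * (bdist (h (Some a)) (h None) * bdist (h (Some z)) (h (Some b)))"
      unfolding cr by (intro mult_right_mono mult_mono mult_nonneg_nonneg cdist_le_2 cdist_nonneg) auto
    finally have main: "bdist (Some (f a)) (Some (f z)) * bdist None (Some (f b)) * (\<delta>' * \<delta>')
      \<le> 4 * (bdist (Some (f a)) None * bdist (Some (f z)) (Some (f b)))"
      by (simp add: f \<open>h None = None\<close>)
    define N where "N w = sqrt (1 + (cmod w)\<^sup>2)" for w
    have N: "N w > 0" for w using one_plus_norm_squared_pos[of w] by (simp add: N_def)
    have bd: "bdist (Some u) (Some w) = 2 * cmod (u - w) / (N u * N w)" "bdist None (Some w) = 2 / N w"
      "bdist (Some w) None = 2 / N w" for u w
      by (simp_all add: emb_simps cdist_Some cdist_None real_sqrt_mult N_def norm_prod_def)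
    \<comment> \<open>The three finite image points contribute the same factor to both sides, which
      leaves a Euclidean inequality.\<close>
    have "4 / (N (f a) * N (f z) * N (f b)) * (cmod (f a - f z) * \<delta>'\<^sup>2)
        \<le> 4 / (N (f a) * N (f z) * N (f b)) * (4 * cmod (f b - f z))"
      using main unfolding bd by (simp add: power2_eq_square mult_ac norm_minus_commute)
    then have "cmod (f a - f z) * \<delta>'\<^sup>2 \<le> 4 * cmod (f b - f z)"
      using N by (subst (asm) mult_le_cancel_left_pos) auto
    then show ?thesis using \<delta>'(1) by (simp add: field_simps)
  qed (use le in simp)
  moreover have "4 / \<delta>'\<^sup>2 > 0" using \<delta>'(1) by simp
  ultimately show thesis using that by blast
qed

section \<open>Functions of bounded dyadic energy\<close>

definition dyadic_incr :: "(real \<Rightarrow> complex) \<Rightarrow> nat \<Rightarrow> nat \<Rightarrow> complex" where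
  "dyadic_incr \<phi> m j = \<phi> (real (Suc j) / 2 ^ m) - \<phi> (real j / 2 ^ m)"

text \<open>The Dirichlet energy on the unit interval of the piecewise linear interpolation of
  \<open>\<phi>\<close> at the multiples of \<open>1 / 2 ^ m\<close>.\<close>

definition dyadic_energy :: "(real \<Rightarrow> complex) \<Rightarrow> nat \<Rightarrow> real" where
  "dyadic_energy \<phi> m = 2 ^ m * (\<Sum>j<2 ^ m. (cmod (dyadic_incr \<phi> m j))\<^sup>2)"

definition dyadic_slope :: "(real \<Rightarrow> complex) \<Rightarrow> nat \<Rightarrow> real \<Rightarrow> complex" where
  "dyadic_slope \<phi> n x = 2 ^ n * dyadic_incr \<phi> n (nat \<lfloor>2 ^ n * x\<rfloor>)"

lemma sum_dyadic_incr:
  assumes "p \<le> q"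
  shows "(\<Sum>j=p..<q. dyadic_incr \<phi> m j) = \<phi> (real q / 2 ^ m) - \<phi> (real p / 2 ^ m)"
  unfolding dyadic_incr_def using sum_Suc_diff'[OF assms, of "\<lambda>j. \<phi> (real j / 2 ^ m)"] by simp

text \<open>The variance identity, to be applied to the fine increments inside one coarse dyadic
  interval.\<close>

lemma sum_norm_diff_mean:
  fixes d :: "nat \<Rightarrow> 'a::real_inner"
  assumes "finite A" "A \<noteq> {}"
  shows "(\<Sum>i\<in>A. (norm (d i - sum d A /\<^sub>R real (card A)))\<^sup>2)
         = (\<Sum>i\<in>A. (norm (d i))\<^sup>2) - (norm (sum d A))\<^sup>2 / real (card A)"
proof -
  define q where "q = real (card A)"
  define S where "S = sum d A"
  have q: "q > 0" using assms by (simp add: q_def card_gt_0_iff)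
  have "(norm (d i - S /\<^sub>R q))\<^sup>2 = (norm (d i))\<^sup>2 - 2 / q * (d i \<bullet> S) + (norm S)\<^sup>2 / q\<^sup>2" for i
    unfolding power2_norm_eq_inner
    by (simp add: inner_diff_left inner_diff_right inner_commute power2_eq_square field_simps)
  then have "(\<Sum>i\<in>A. (norm (d i - S /\<^sub>R q))\<^sup>2)
      = (\<Sum>i\<in>A. (norm (d i))\<^sup>2) - 2 / q * (\<Sum>i\<in>A. d i \<bullet> S) + q * ((norm S)\<^sup>2 / q\<^sup>2)"
    by (simp add: sum.distrib sum_subtractf sum_distrib_left q_def)
  also have "(\<Sum>i\<in>A. d i \<bullet> S) = (norm S)\<^sup>2"
    by (simp add: S_def inner_sum_left power2_norm_eq_inner)
  finally show ?thesis
    using q by (simp add: S_def q_def power2_eq_square field_simps)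
qed

text \<open>The slopes of the piecewise linear dyadic interpolations form a martingale; this is the
  orthogonality of its increments.\<close>

lemma dyadic_energy_diff:
  assumes "n \<le> m"
  shows "2 ^ m * (\<Sum>j<2 ^ m. (cmod (dyadic_incr \<phi> m j - dyadic_incr \<phi> n (j div 2 ^ (m - n)) / 2 ^ (m - n)))\<^sup>2)
         = dyadic_energy \<phi> m - dyadic_energy \<phi> n"
proof -
  define q where "q = (2::nat) ^ (m - n)"
  have q: "q > 0" by (simp add: q_def)
  have mq: "(2::nat) ^ m = 2 ^ n * q"
    using assms by (simp add: q_def flip: power_add)
  have mqr: "(2::real) ^ m = 2 ^ n * real q"
    using arg_cong[OF mq, of real] by simp
  have group: "(\<Sum>j<2 ^ m. F j) = (\<Sum>k<2 ^ n. \<Sum>j=k * q..<k * q + q. F j)" for F :: "nat \<Rightarrow> real"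
    unfolding mq by (rule sum.nat_group[symmetric])
  have "(\<Sum>j=k * q..<k * q + q. (cmod (dyadic_incr \<phi> m j - dyadic_incr \<phi> n (j div q) / q))\<^sup>2)
      = (\<Sum>j=k * q..<k * q + q. (cmod (dyadic_incr \<phi> m j))\<^sup>2) - (cmod (dyadic_incr \<phi> n k))\<^sup>2 / q"
    (is "?l = ?r") for k
  proof -
    \<comment> \<open>By telescoping, the increment at level \<open>n\<close> divided by
      \<open>q\<close> is the mean of the \<open>q\<close> increments inside its interval.\<close>
    have "(\<Sum>j=k * q..<k * q + q. dyadic_incr \<phi> m j) = dyadic_incr \<phi> n k"
    proof -
      have "real (k * q + q) / 2 ^ m = real (Suc k) / 2 ^ n" "real (k * q) / 2 ^ m = real k / 2 ^ n"
        using q unfolding mqr by (simp_all add: field_simps)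
      then show ?thesis
        by (simp add: sum_dyadic_incr) (simp add: dyadic_incr_def)
    qed
    moreover have "j div q = k" if "j \<in> {k * q..<k * q + q}" for j
      using that q by (intro div_nat_eqI) (auto simp: algebra_simps)
    ultimately show ?thesis
      using sum_norm_diff_mean[of "{k * q..<k * q + q}" "dyadic_incr \<phi> m"] q
      by (simp add: scaleR_conv_of_real divide_inverse mult.commute)
  qed
  then have "(\<Sum>j<2 ^ m. (cmod (dyadic_incr \<phi> m j - dyadic_incr \<phi> n (j div q) / q))\<^sup>2)
      = (\<Sum>j<2 ^ m. (cmod (dyadic_incr \<phi> m j))\<^sup>2) - (\<Sum>k<2 ^ n. (cmod (dyadic_incr \<phi> n k))\<^sup>2) / q"
    unfolding group by (simp add: sum_subtractf sum_divide_distrib)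
  then have "2 ^ m * (\<Sum>j<2 ^ m. (cmod (dyadic_incr \<phi> m j - dyadic_incr \<phi> n (j div q) / q))\<^sup>2)
      = dyadic_energy \<phi> m - 2 ^ m * ((\<Sum>k<2 ^ n. (cmod (dyadic_incr \<phi> n k))\<^sup>2) / q)"
    by (simp only: dyadic_energy_def right_diff_distrib)
  also have "2 ^ m * ((\<Sum>k<2 ^ n. (cmod (dyadic_incr \<phi> n k))\<^sup>2) / q) = dyadic_energy \<phi> n"
    using q unfolding mqr dyadic_energy_def by simp
  finally show ?thesis by (simp add: q_def)
qed

lemma incseq_dyadic_energy: "incseq (dyadic_energy \<phi>)"
proof (unfold incseq_def, intro allI impI)
  fix n m :: nat assume "n \<le> m"
  then show "dyadic_energy \<phi> n \<le> dyadic_energy \<phi> m"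
    by (subst diff_ge_0_iff_ge[symmetric], subst dyadic_energy_diff[symmetric]) (simp_all add: sum_nonneg)
qed

lemma dyadic_energy_tail:
  assumes "\<And>m. dyadic_energy \<phi> m \<le> M" "\<epsilon> > 0"
  obtains n where "\<And>m. n \<le> m \<Longrightarrow> dyadic_energy \<phi> m - dyadic_energy \<phi> n \<le> \<epsilon>"
proof -
  obtain L where L: "dyadic_energy \<phi> \<longlonglongrightarrow> L" "\<And>i. dyadic_energy \<phi> i \<le> L"
    using incseq_convergent[OF incseq_dyadic_energy] assms(1) by metis
  then obtain n where "L - \<epsilon> < dyadic_energy \<phi> n"
    using order_tendstoD(1)[OF L(1), of "L - \<epsilon>"] \<open>\<epsilon> > 0\<close> by (auto simp: eventually_sequentially)
  then have "dyadic_energy \<phi> m - dyadic_energy \<phi> n \<le> \<epsilon>" for m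
    using L(2)[of m] by linarith
  then show thesis using that by blast
qed

lemma norm_sum_squared_le:
  fixes d :: "'b \<Rightarrow> 'a::real_normed_vector"
  shows "(norm (sum d A))\<^sup>2 \<le> real (card A) * (\<Sum>j\<in>A. (norm (d j))\<^sup>2)"
proof -
  have "(norm (sum d A))\<^sup>2 \<le> (\<Sum>j\<in>A. norm (d j) * 1)\<^sup>2"
    by (intro power_mono) (auto intro: norm_sum)
  also have "\<dots> \<le> (\<Sum>j\<in>A. (norm (d j))\<^sup>2) * (\<Sum>j\<in>A. 1\<^sup>2)"
    by (rule Cauchy_Schwarz_ineq_sum)
  finally show ?thesis by (simp add: mult.commute)
qed

section \<open>Deviation from the dyadic interpolation of a fixed level\<close>

lemma nat_floor_dyadic_div:
  assumes "n \<le> m" "0 \<le> x"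
  shows "nat \<lfloor>2 ^ m * x\<rfloor> div 2 ^ (m - n) = nat \<lfloor>2 ^ n * x :: real\<rfloor>"
proof -
  have "2 ^ n * x = 2 ^ m * x / real_of_int (2 ^ (m - n))"
    using assms power_add[of "2::real" "m - n" n] by simp
  then have "\<lfloor>2 ^ n * x\<rfloor> = \<lfloor>2 ^ m * x\<rfloor> div 2 ^ (m - n)"
    by (metis floor_divide_real_eq_div zero_le_numeral zero_le_power)
  then show ?thesis
    using assms by (simp add: nat_div_distrib nat_power_eq)
qed

lemma nat_floor_dyadic_tendsto:
  assumes "0 \<le> x"
  shows "(\<lambda>m. real (nat \<lfloor>2 ^ m * x\<rfloor>) / 2 ^ m) \<longlonglongrightarrow> x"
proof (rule tendsto_sandwich)
  show "\<forall>\<^sub>F m in sequentially. x - (1/2) ^ m \<le> real (nat \<lfloor>2 ^ m * x\<rfloor>) / 2 ^ m"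
  proof (intro always_eventually allI)
    fix m
    have "2 ^ m * x - 1 \<le> real (nat \<lfloor>2 ^ m * x\<rfloor>)" using assms by linarith
    then have "(2 ^ m * x - 1) / 2 ^ m \<le> real (nat \<lfloor>2 ^ m * x\<rfloor>) / 2 ^ m"
      by (intro divide_right_mono) auto
    then show "x - (1/2) ^ m \<le> real (nat \<lfloor>2 ^ m * x\<rfloor>) / 2 ^ m"
      by (simp add: diff_divide_distrib power_divide)
  qed
  show "\<forall>\<^sub>F m in sequentially. real (nat \<lfloor>2 ^ m * x\<rfloor>) / 2 ^ m \<le> x"
    using assms by (auto intro!: always_eventually simp: pos_divide_le_eq mult.commute[of _ "2 ^ _"])
  have "(\<lambda>m. x - (1/2) ^ m) \<longlonglongrightarrow> x - 0"
    by (intro tendsto_intros) auto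
  then show "(\<lambda>m. x - (1/2) ^ m) \<longlonglongrightarrow> x" by simp
qed auto

text \<open>Round the endpoints down to level \<open>m\<close>. Cauchy-Schwarz bounds each term by
  the energy, on its interval, of the difference of the interpolations at levels \<open>m\<close>
  and \<open>n\<close>. By disjointness these add up to at most the energy gap, and continuity
  permits the limit in \<open>m\<close>.\<close>

lemma dyadic_deviation_sum_le:
  assumes cont: "continuous_on UNIV \<phi>"
    and tail: "\<And>m. n \<le> m \<Longrightarrow> dyadic_energy \<phi> m - dyadic_energy \<phi> n \<le> \<epsilon>"
    and fin: "finite I"
    and st: "\<And>i. i \<in> I \<Longrightarrow> 0 \<le> s i \<and> s i < t i \<and> t i < 1"
    and same: "\<And>i. i \<in> I \<Longrightarrow> \<lfloor>2 ^ n * s i\<rfloor> = \<lfloor>2 ^ n * t i\<rfloor>"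
    and disj: "\<And>i j. i \<in> I \<Longrightarrow> j \<in> I \<Longrightarrow> i \<noteq> j \<Longrightarrow> {s i..t i} \<inter> {s j..t j} = {}"
  shows "(\<Sum>i\<in>I. (cmod (\<phi> (t i) - \<phi> (s i) - of_real (t i - s i) * dyadic_slope \<phi> n (s i)))\<^sup>2 / (t i - s i)) \<le> \<epsilon>"
proof -
  define a where "a m x = nat \<lfloor>2 ^ m * x\<rfloor>" for m :: nat and x :: real
  define r where "r m x = real (a m x) / 2 ^ m" for m :: nat and x :: real
  define d where "d m j = dyadic_incr \<phi> m j - dyadic_incr \<phi> n (j div 2 ^ (m - n)) / 2 ^ (m - n)" for m j
  define X where "X m i = (cmod (\<phi> (r m (t i)) - \<phi> (r m (s i))
      - of_real (r m (t i) - r m (s i)) * dyadic_slope \<phi> n (s i)))\<^sup>2 / (r m (t i) - r m (s i))" for m i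
  have amono: "a m x \<le> a m y" if "x \<le> y" for m x y
    unfolding a_def using that by (intro nat_mono floor_mono) simp
  have rlim: "(\<lambda>m. r m x) \<longlonglongrightarrow> x" if "0 \<le> x" for x
    unfolding r_def a_def by (rule nat_floor_dyadic_tendsto[OF that])
  have "(\<Sum>i\<in>I. X m i) \<le> \<epsilon>" if "n \<le> m" for m
  proof -
    have Xle: "X m i \<le> 2 ^ m * (\<Sum>j=a m (s i)..<a m (t i). (cmod (d m j))\<^sup>2)" if i: "i \<in> I" for i
    proof -
      define p q where "p = a m (s i)" and "q = a m (t i)"
      have pq: "p \<le> q" unfolding p_def q_def using st[OF i] by (intro amono) simp
      \<comment> \<open>Both endpoints lie in one interval of level \<open>n\<close>, so all indices
        between them have the same ancestor there and the subtracted slope is constant.\<close>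
      have div_eq: "j div 2 ^ (m - n) = a n (s i)" if j: "j \<in> {p..<q}" for j
      proof -
        have "p div 2 ^ (m - n) = a n (s i)" "q div 2 ^ (m - n) = a n (s i)"
          unfolding p_def q_def a_def using nat_floor_dyadic_div[OF \<open>n \<le> m\<close>] st[OF i] same[OF i] by auto
        moreover have "p div 2 ^ (m - n) \<le> j div 2 ^ (m - n)" "j div 2 ^ (m - n) \<le> q div 2 ^ (m - n)"
          using j by (auto intro: div_le_mono)
        ultimately show ?thesis by simp
      qed
      have "(\<Sum>j=p..<q. d m j)
          = (\<Sum>j=p..<q. dyadic_incr \<phi> m j) - (\<Sum>j=p..<q. dyadic_incr \<phi> n (a n (s i)) / 2 ^ (m - n))"
        by (simp only: d_def sum_subtractf[symmetric]) (intro sum.cong, simp_all add: div_eq)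
      also have "\<dots> = \<phi> (r m (t i)) - \<phi> (r m (s i)) - of_real (r m (t i) - r m (s i)) * dyadic_slope \<phi> n (s i)"
        using pq \<open>n \<le> m\<close>
        by (simp add: sum_dyadic_incr r_def p_def q_def dyadic_slope_def power_diff a_def[symmetric])
          (simp add: field_simps)
      finally have "X m i = (cmod (\<Sum>j=p..<q. d m j))\<^sup>2 / ((real q - real p) / 2 ^ m)"
        by (simp add: X_def r_def p_def q_def diff_divide_distrib)
      also have "\<dots> \<le> 2 ^ m * (\<Sum>j=p..<q. (cmod (d m j))\<^sup>2)"
      \<comment> \<open>If both endpoints round to the same point, the left side is 0 by the
        convention for division by zero, and the sum is empty.\<close>
      proof (cases "p = q")
        case False
        then have "(cmod (\<Sum>j=p..<q. d m j))\<^sup>2 / (real q - real p) \<le> (\<Sum>j=p..<q. (cmod (d m j))\<^sup>2)"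
          using norm_sum_squared_le[of "d m" "{p..<q}"] pq
          by (subst pos_divide_le_eq) (simp_all add: mult.commute)
        from mult_left_mono[OF this, of "2 ^ m"] show ?thesis by (simp add: mult.commute)
      qed simp
      finally show ?thesis by (simp add: p_def q_def)
    qed
    have "(\<Sum>i\<in>I. X m i) \<le> (\<Sum>i\<in>I. 2 ^ m * (\<Sum>j=a m (s i)..<a m (t i). (cmod (d m j))\<^sup>2))"
      by (intro sum_mono Xle)
    also have "\<dots> = 2 ^ m * (\<Sum>j\<in>(\<Union>i\<in>I. {a m (s i)..<a m (t i)}). (cmod (d m j))\<^sup>2)"
    proof -
      have "{a m (s i)..<a m (t i)} \<inter> {a m (s j)..<a m (t j)} = {}" if ij: "i \<in> I" "j \<in> I" "i \<noteq> j" for i j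
      proof -
        \<comment> \<open>Disjoint intervals are ordered on the line, so their rounded index ranges
          cannot overlap.\<close>
        have "t i < s j \<or> t j < s i"
        proof (rule ccontr)
          assume "\<not> ?thesis"
          then have "max (s i) (s j) \<in> {s i..t i} \<inter> {s j..t j}"
            using st[OF ij(1)] st[OF ij(2)] by auto
          then show False using disj[OF ij] by blast
        qed
        then show ?thesis using amono[of "t i" "s j" m] amono[of "t j" "s i" m] by auto
      qed
      then show ?thesis
        using fin by (subst sum.UNION_disjoint) (auto simp: sum_distrib_left)
    qed
    also have "\<dots> \<le> 2 ^ m * (\<Sum>j<2 ^ m. (cmod (d m j))\<^sup>2)"
    proof -
      have "a m (t i) \<le> 2 ^ m" if "i \<in> I" for i
        using amono[of "t i" 1 m] st[OF that] by (simp add: a_def nat_power_eq)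
      then show ?thesis
        by (intro mult_left_mono sum_mono2) (auto intro: less_le_trans)
    qed
    also have "\<dots> \<le> \<epsilon>"
      unfolding d_def using dyadic_energy_diff[OF \<open>n \<le> m\<close>] tail[OF \<open>n \<le> m\<close>] by simp
    finally show ?thesis .
  qed
  moreover have "(\<lambda>m. \<Sum>i\<in>I. X m i)
      \<longlonglongrightarrow> (\<Sum>i\<in>I. (cmod (\<phi> (t i) - \<phi> (s i) - of_real (t i - s i) * dyadic_slope \<phi> n (s i)))\<^sup>2 / (t i - s i))"
  proof (intro tendsto_sum)
    fix i assume i: "i \<in> I"
    have "(\<lambda>m. r m (t i)) \<longlonglongrightarrow> t i" "(\<lambda>m. r m (s i)) \<longlonglongrightarrow> s i"
      using st[OF i] by (auto intro: rlim)
    moreover from this have "(\<lambda>m. \<phi> (r m (t i))) \<longlonglongrightarrow> \<phi> (t i)" "(\<lambda>m. \<phi> (r m (s i))) \<longlonglongrightarrow> \<phi> (s i)"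
      by (auto intro: continuous_on_tendsto_compose[OF cont])
    ultimately show "(\<lambda>m. X m i)
        \<longlonglongrightarrow> (cmod (\<phi> (t i) - \<phi> (s i) - of_real (t i - s i) * dyadic_slope \<phi> n (s i)))\<^sup>2 / (t i - s i)"
      unfolding X_def using st[OF i] by (intro tendsto_intros) auto
  qed
  ultimately show ?thesis
    by (intro LIMSEQ_le_const2) auto
qed

text \<open>A weak type maximal inequality for \<open>\<phi>\<close> minus its interpolation at level \<open>n\<close>.\<close>

lemma dyadic_deviation_maximal:
  assumes cont: "continuous_on UNIV \<phi>"
    and tail: "\<And>m. n \<le> m \<Longrightarrow> dyadic_energy \<phi> m - dyadic_energy \<phi> n \<le> \<epsilon>"
    and "\<kappa> > 0"
  obtains T where "T \<in> lmeasurable" "measure lebesgue T \<le> 5 * \<epsilon> / \<kappa>\<^sup>2"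
    "\<forall>x\<in>{0<..<1} - T. \<forall>t\<in>{0<..<1}. \<lfloor>2 ^ n * t\<rfloor> = \<lfloor>2 ^ n * x\<rfloor>
       \<longrightarrow> cmod (\<phi> t - \<phi> x - of_real (t - x) * dyadic_slope \<phi> n x) \<le> \<kappa> * \<bar>t - x\<bar>"
proof -
  define dev where "dev x t \<longleftrightarrow> x \<in> {0<..<1} \<and> t \<in> {0<..<1} \<and> \<lfloor>2 ^ n * t\<rfloor> = \<lfloor>2 ^ n * x\<rfloor>
     \<and> cmod (\<phi> t - \<phi> x - of_real (t - x) * dyadic_slope \<phi> n x) > \<kappa> * \<bar>t - x\<bar>" for x t :: real
  define B where "B = {x. \<exists>t. dev x t}"
  define \<tau> where "\<tau> x = (SOME t. dev x t)" for x
  have dev: "dev x (\<tau> x)" if "x \<in> B" for x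
    using that unfolding B_def \<tau>_def by (auto intro: someI_ex)
  define lo hi where "lo x = min x (\<tau> x)" and "hi x = max x (\<tau> x)" for x
  define c r where "c x = (x + \<tau> x) / 2" and "r x = \<bar>\<tau> x - x\<bar> / 2" for x
  have r: "0 < r x" "r x \<le> 1" if "x \<in> B" for x
    using dev[OF that] by (auto simp: dev_def r_def)
  have cball: "cball (c x) (r x) = {lo x..hi x}" for x
  proof -
    have "c x - r x = lo x" "c x + r x = hi x"
      by (auto simp: c_def r_def lo_def hi_def min_def max_def field_simps)
    then show ?thesis by (simp add: cball_eq_atLeastAtMost)
  qed
  have "x \<in> cball (c x) (r x)" for x
    unfolding cball by (simp add: lo_def hi_def)
  then have sub: "B \<subseteq> (\<Union>x\<in>B. cball (c x) (r x))" by blast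
  \<comment> \<open>Every bad point lies in the closed interval between itself and a partner
    witnessing the deviation. Vitali selects disjoint ones whose fivefold enlargements still cover
    the bad points; hence the 5 in the bound.\<close>
  obtain C where C: "countable C" "C \<subseteq> B"
    "pairwise (\<lambda>i j. disjnt (cball (c i) (r i)) (cball (c j) (r j))) C"
    "B \<subseteq> (\<Union>i\<in>C. cball (c i) (5 * r i))"
    by (rule Vitali_covering_lemma_cballs[OF sub, of 1]) (use r in blast)+
  define T where "T = (\<Union>i\<in>C. cball (c i) (5 * r i))"
  \<comment> \<open>A bound that is uniform over finite subfamilies passes to the countable
    union.\<close>
  have bound: "measure lebesgue (\<Union>i\<in>F. cball (c i) (5 * r i)) \<le> 5 * \<epsilon> / \<kappa>\<^sup>2"
    if F: "F \<subseteq> C" "finite F" for F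
  proof -
    define w where "w i = (cmod (\<phi> (hi i) - \<phi> (lo i) - of_real (hi i - lo i) * dyadic_slope \<phi> n (lo i)))\<^sup>2 / (hi i - lo i)" for i
    have FB: "i \<in> B" if "i \<in> F" for i using that F C(2) by blast
    have hl: "hi i - lo i = 2 * r i" for i by (auto simp: hi_def lo_def r_def)
    have fl: "\<lfloor>2 ^ n * lo i\<rfloor> = \<lfloor>2 ^ n * i\<rfloor>" "\<lfloor>2 ^ n * hi i\<rfloor> = \<lfloor>2 ^ n * i\<rfloor>" if "i \<in> F" for i
      using dev[OF FB[OF that]] by (auto simp: dev_def lo_def hi_def min_def max_def)
    have "sum w F \<le> \<epsilon>"
      unfolding w_def
    proof (rule dyadic_deviation_sum_le[OF cont tail \<open>finite F\<close>])
      fix i assume i: "i \<in> F"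
      show "0 \<le> lo i \<and> lo i < hi i \<and> hi i < 1"
        using dev[OF FB[OF i]] r(1)[OF FB[OF i]] by (auto simp: dev_def lo_def hi_def r_def)
      show "\<lfloor>2 ^ n * lo i\<rfloor> = \<lfloor>2 ^ n * hi i\<rfloor>" using fl[OF i] by simp
    next
      fix i j assume "i \<in> F" "j \<in> F" "i \<noteq> j"
      then show "{lo i..hi i} \<inter> {lo j..hi j} = {}"
        using C(3) F(1) unfolding pairwise_def disjnt_def cball by blast
    qed
    moreover have "\<kappa>\<^sup>2 * (2 * r i) \<le> w i" if i: "i \<in> F" for i
    proof -
      \<comment> \<open>The slope is constant on an interval of level \<open>n\<close>, so
        exchanging the endpoints only changes the sign of the deviation.\<close>
      have "dyadic_slope \<phi> n (lo i) = dyadic_slope \<phi> n i"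
        unfolding dyadic_slope_def fl[OF i] ..
      then have "cmod (\<phi> (hi i) - \<phi> (lo i) - of_real (hi i - lo i) * dyadic_slope \<phi> n (lo i))
          = cmod (\<phi> (\<tau> i) - \<phi> i - of_real (\<tau> i - i) * dyadic_slope \<phi> n i)"
      proof (cases "i \<le> \<tau> i")
        case False
        have "\<phi> i - \<phi> (\<tau> i) - of_real (i - \<tau> i) * dyadic_slope \<phi> n i
            = - (\<phi> (\<tau> i) - \<phi> i - of_real (\<tau> i - i) * dyadic_slope \<phi> n i)"
          by (simp add: algebra_simps)
        then have "cmod (\<phi> i - \<phi> (\<tau> i) - of_real (i - \<tau> i) * dyadic_slope \<phi> n i)
            = cmod (\<phi> (\<tau> i) - \<phi> i - of_real (\<tau> i - i) * dyadic_slope \<phi> n i)"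
          by (simp only: norm_minus_cancel)
        with False \<open>dyadic_slope \<phi> n (lo i) = dyadic_slope \<phi> n i\<close> show ?thesis
          by (simp add: hi_def lo_def)
      qed (simp add: hi_def lo_def)
      also have "\<dots> \<ge> \<kappa> * (2 * r i)"
        using dev[OF FB[OF i]] by (auto simp: dev_def r_def)
      finally have "(\<kappa> * (2 * r i))\<^sup>2 \<le> (cmod (\<phi> (hi i) - \<phi> (lo i) - of_real (hi i - lo i) * dyadic_slope \<phi> n (lo i)))\<^sup>2"
        using \<open>\<kappa> > 0\<close> r(1)[OF FB[OF i]] by (intro power_mono) auto
      then show ?thesis
        using r(1)[OF FB[OF i]] unfolding w_def hl by (simp add: field_simps power2_eq_square)
    qed
    then have "(\<Sum>i\<in>F. \<kappa>\<^sup>2 * (2 * r i)) \<le> sum w F" by (rule sum_mono)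
    ultimately have "\<kappa>\<^sup>2 * (\<Sum>i\<in>F. 2 * r i) \<le> \<epsilon>" by (simp add: sum_distrib_left)
    then have le: "5 * (\<Sum>i\<in>F. 2 * r i) \<le> 5 * \<epsilon> / \<kappa>\<^sup>2"
      using \<open>\<kappa> > 0\<close> by (simp add: field_simps)
    have "measure lebesgue (\<Union>i\<in>F. cball (c i) (5 * r i)) \<le> (\<Sum>i\<in>F. measure lebesgue (cball (c i) (5 * r i)))"
      using \<open>finite F\<close> by (intro measure_UNION_le) auto
    also have "\<dots> = (\<Sum>i\<in>F. 5 * (2 * r i))"
      using r(1)[OF FB] by (intro sum.cong) (auto simp: cball_eq_atLeastAtMost order_less_imp_le)
    finally show ?thesis using le by (simp add: sum_distrib_left)
  qed
  show thesis
  proof (rule that[of T])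
    show "T \<in> lmeasurable" unfolding T_def
      by (rule fmeasurable_UN_bound[OF C(1) _ bound]) auto
    show "measure lebesgue T \<le> 5 * \<epsilon> / \<kappa>\<^sup>2" unfolding T_def
      by (rule measure_UN_bound[OF C(1) _ bound]) auto
    show "\<forall>x\<in>{0<..<1} - T. \<forall>t\<in>{0<..<1}. \<lfloor>2 ^ n * t\<rfloor> = \<lfloor>2 ^ n * x\<rfloor>
       \<longrightarrow> cmod (\<phi> t - \<phi> x - of_real (t - x) * dyadic_slope \<phi> n x) \<le> \<kappa> * \<bar>t - x\<bar>"
    proof (intro ballI impI, rule ccontr)
      fix x t assume xt: "x \<in> {0<..<1} - T" "t \<in> {0<..<1}" "\<lfloor>2 ^ n * t\<rfloor> = \<lfloor>2 ^ n * x\<rfloor>"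
        and "\<not> cmod (\<phi> t - \<phi> x - of_real (t - x) * dyadic_slope \<phi> n x) \<le> \<kappa> * \<bar>t - x\<bar>"
      then have "dev x t" by (simp add: dev_def)
      then show False using C(4) xt(1) by (auto simp: B_def T_def)
    qed
  qed
qed

section \<open>Difference quotients at almost every point of an interval\<close>

definition dyadic_rationals :: "real set" where
  "dyadic_rationals = (\<Union>n. range (\<lambda>k::int. of_int k / 2 ^ n))"

lemma negligible_dyadic_rationals: "negligible dyadic_rationals"
  unfolding dyadic_rationals_def negligible_iff_null_sets
  by (intro null_sets_completionI countable_imp_null_set_lborel) auto

lemma floor_dyadic_locally_constant:
  assumes "x \<notin> dyadic_rationals"
  shows "\<forall>\<^sub>F t in at (0::real). \<lfloor>2 ^ n * (x + t)\<rfloor> = \<lfloor>2 ^ n * x\<rfloor>"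
proof -
  have "2 ^ n * x \<notin> \<int>"
  proof
    assume "2 ^ n * x \<in> \<int>"
    then obtain k where "2 ^ n * x = of_int k" by (auto elim: Ints_cases)
    then have "x = of_int k / 2 ^ n" by (simp add: field_simps)
    then show False using assms by (auto simp: dyadic_rationals_def)
  qed
  moreover have "((\<lambda>t. 2 ^ n * (x + t)) \<longlongrightarrow> 2 ^ n * (x + 0)) (at 0)"
    by (intro tendsto_intros)
  ultimately show ?thesis
    by (intro eventually_floor_eq) auto
qed

text \<open>Dividing the deviation bound by \<open>t\<close> puts all short quotients at
  \<open>x\<close> near a single number. Off the dyadic rationals, nearby points on both sides share
  the level \<open>n\<close> interval of \<open>x\<close>.\<close>

lemma dyadic_quotients_near_slope:
  assumes cont: "continuous_on UNIV \<phi>" and energy: "\<And>m. dyadic_energy \<phi> m \<le> M"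
    and "\<kappa> > 0" "\<epsilon> > 0"
  obtains n T where "T \<in> lmeasurable" "measure lebesgue T \<le> \<epsilon>"
    "\<forall>x\<in>{0<..<1} - (T \<union> dyadic_rationals).
      \<forall>\<^sub>F t in at 0. cmod ((\<phi> (x + t) - \<phi> x) / of_real t - dyadic_slope \<phi> n x) \<le> \<kappa>"
proof -
  \<comment> \<open>The factor \<open>5 / \<kappa>\<^sup>2\<close> of the maximal inequality turns
    this tail into \<open>\<epsilon>\<close>.\<close>
  obtain n where tail: "\<And>m. n \<le> m \<Longrightarrow> dyadic_energy \<phi> m - dyadic_energy \<phi> n \<le> \<epsilon> * \<kappa>\<^sup>2 / 5"
    using dyadic_energy_tail[OF energy, of "\<epsilon> * \<kappa>\<^sup>2 / 5"] assms by auto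
  obtain T where T: "T \<in> lmeasurable" "measure lebesgue T \<le> 5 * (\<epsilon> * \<kappa>\<^sup>2 / 5) / \<kappa>\<^sup>2"
    and near: "\<forall>x\<in>{0<..<1} - T. \<forall>t\<in>{0<..<1}. \<lfloor>2 ^ n * t\<rfloor> = \<lfloor>2 ^ n * x\<rfloor>
       \<longrightarrow> cmod (\<phi> t - \<phi> x - of_real (t - x) * dyadic_slope \<phi> n x) \<le> \<kappa> * \<bar>t - x\<bar>"
    by (rule dyadic_deviation_maximal[OF cont tail \<open>\<kappa> > 0\<close>]) (assumption, rule that)
  show thesis
  proof (rule that[OF T(1)])
    show "measure lebesgue T \<le> \<epsilon>" using T(2) \<open>\<kappa> > 0\<close> by simp
  next
    show "\<forall>x\<in>{0<..<1} - (T \<union> dyadic_rationals).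
      \<forall>\<^sub>F t in at 0. cmod ((\<phi> (x + t) - \<phi> x) / of_real t - dyadic_slope \<phi> n x) \<le> \<kappa>"
    proof
      fix x assume x: "x \<in> {0<..<1} - (T \<union> dyadic_rationals)"
      have "((\<lambda>t. x + t) \<longlongrightarrow> x + 0) (at 0)" by (intro tendsto_intros)
      then have "\<forall>\<^sub>F t in at 0. x + t \<in> {0<..<1}"
        using x by (intro topological_tendstoD) auto
      moreover have "\<forall>\<^sub>F t in at 0. \<lfloor>2 ^ n * (x + t)\<rfloor> = \<lfloor>2 ^ n * x\<rfloor>"
        using x by (intro floor_dyadic_locally_constant) auto
      moreover have "\<forall>\<^sub>F t in at (0::real). t \<noteq> 0"
        by (simp add: eventually_at_filter)
      ultimately show "\<forall>\<^sub>F t in at 0. cmod ((\<phi> (x + t) - \<phi> x) / of_real t - dyadic_slope \<phi> n x) \<le> \<kappa>"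
      proof eventually_elim
        case (elim t)
        have "(\<phi> (x + t) - \<phi> x) / of_real t - dyadic_slope \<phi> n x
            = (\<phi> (x + t) - \<phi> x - of_real t * dyadic_slope \<phi> n x) / of_real t"
          using elim by (simp add: field_simps)
        then show ?case
          using near[rule_format, of x "x + t"] elim x by (simp add: norm_divide field_simps)
      qed
    qed
  qed
qed

text \<open>Short quotients within \<open>\<kappa> / 2\<close> of the same slope are within
  \<open>\<kappa>\<close> of each other. Apart from dyadic rationals, the set therefore lies in
  exceptional sets of arbitrarily small measure.\<close>

lemma negligible_oscillating_quotients:
  assumes cont: "continuous_on UNIV \<phi>" and energy: "\<And>m. dyadic_energy \<phi> m \<le> M" and "\<kappa> > 0"
  shows "negligible {x\<in>{0<..<1}. \<forall>\<delta>>0. \<exists>s t. s \<noteq> 0 \<and> t \<noteq> 0 \<and> \<bar>s\<bar> < \<delta> \<and> \<bar>t\<bar> < \<delta> \<and>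
     cmod ((\<phi> (x + s) - \<phi> x) / of_real s - (\<phi> (x + t) - \<phi> x) / of_real t) > \<kappa>}" (is "negligible ?S")
proof -
  have "negligible (?S - dyadic_rationals)"
    unfolding negligible_outer_le
  proof (intro allI impI)
    fix e :: real assume "e > 0"
    obtain n T where T: "T \<in> lmeasurable" "measure lebesgue T \<le> e"
      and near: "\<forall>x\<in>{0<..<1} - (T \<union> dyadic_rationals).
        \<forall>\<^sub>F t in at 0. cmod ((\<phi> (x + t) - \<phi> x) / of_real t - dyadic_slope \<phi> n x) \<le> \<kappa> / 2"
      by (rule dyadic_quotients_near_slope[OF cont energy half_gt_zero[OF \<open>\<kappa> > 0\<close>] \<open>e > 0\<close>]) (rule that)
    have "x \<in> T" if x: "x \<in> ?S - dyadic_rationals" for x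
    proof (rule ccontr)
      assume "x \<notin> T"
      then obtain \<delta> where \<delta>: "\<delta> > 0"
        "\<And>t. t \<noteq> 0 \<Longrightarrow> \<bar>t\<bar> < \<delta> \<Longrightarrow> cmod ((\<phi> (x + t) - \<phi> x) / of_real t - dyadic_slope \<phi> n x) \<le> \<kappa> / 2"
        using near[rule_format, of x] x by (auto simp: eventually_at)
      obtain s t where st: "s \<noteq> 0" "t \<noteq> 0" "\<bar>s\<bar> < \<delta>" "\<bar>t\<bar> < \<delta>"
        "cmod ((\<phi> (x + s) - \<phi> x) / of_real s - (\<phi> (x + t) - \<phi> x) / of_real t) > \<kappa>"
        using x \<open>\<delta> > 0\<close> by blast
      show False
        using norm_diff_triangle_le[OF \<delta>(2)[OF st(1,3)], of "(\<phi> (x + t) - \<phi> x) / of_real t" "\<kappa> / 2"]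
          \<delta>(2)[OF st(2,4)] st(5) by (simp add: norm_minus_commute)
    qed
    then show "\<exists>T. ?S - dyadic_rationals \<subseteq> T \<and> T \<in> lmeasurable \<and> measure lebesgue T \<le> e"
      using T by blast
  qed
  then have "negligible ((?S - dyadic_rationals) \<union> dyadic_rationals)"
    using negligible_dyadic_rationals by (rule negligible_Un)
  then show ?thesis by (rule negligible_subset) blast
qed

text \<open>The energy bound rules out Cantor-like behaviour. Steep dyadic intervals have small
  total length, so by Cauchy-Schwarz they contribute little to the total increment; the flat ones
  contribute little anyway.\<close>

lemma eq_endpoints_if_quotients_tendsto_0:
  assumes cont: "continuous_on UNIV \<phi>" and energy: "\<And>m. dyadic_energy \<phi> m \<le> M"
    and zero: "negligible {x\<in>{0<..<1}. \<not> ((\<lambda>t. (\<phi> (x + t) - \<phi> x) / of_real t) \<longlongrightarrow> 0) (at (0::real))}"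
      (is "negligible ?Z")
  shows "\<phi> 1 = \<phi> 0"
proof -
  have *: "cmod (\<phi> 1 - \<phi> 0) \<le> 2 * \<kappa>" if "\<kappa> > 0" for \<kappa>
  proof -
    have "0 \<le> dyadic_energy \<phi> 0" by (simp add: dyadic_energy_def)
    then have "M \<ge> 0" using energy[of 0] by linarith
    \<comment> \<open>Chosen so that \<open>\<epsilon> * M\<close> is at most
      \<open>\<kappa>\<^sup>2\<close>; adding 1 keeps the denominator positive when
      \<open>M = 0\<close>.\<close>
    define \<epsilon> where "\<epsilon> = \<kappa>\<^sup>2 / (M + 1)"
    have "\<epsilon> > 0" using \<open>\<kappa> > 0\<close> \<open>M \<ge> 0\<close> by (simp add: \<epsilon>_def)
    obtain n T where T: "T \<in> lmeasurable" "measure lebesgue T \<le> \<epsilon>"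
      and near: "\<forall>x\<in>{0<..<1} - (T \<union> dyadic_rationals).
        \<forall>\<^sub>F t in at 0. cmod ((\<phi> (x + t) - \<phi> x) / of_real t - dyadic_slope \<phi> n x) \<le> \<kappa>"
      by (rule dyadic_quotients_near_slope[OF cont energy \<open>\<kappa> > 0\<close> \<open>\<epsilon> > 0\<close>]) (rule that)
    define d where "d = dyadic_incr \<phi> n"
    define bad where "bad = {k. k < 2 ^ n \<and> cmod (d k) > \<kappa> / 2 ^ n}"
    define J where "J k = {real k / 2 ^ n<..<real (Suc k) / 2 ^ n}" for k
    have fin: "finite bad" "bad \<subseteq> {..<2 ^ n}" by (auto simp: bad_def)
    have floorJ: "\<lfloor>2 ^ n * x\<rfloor> = int k" if "x \<in> J k" for x k
      using that by (intro floor_unique) (auto simp: J_def field_simps)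
    have slope_le: "cmod (dyadic_slope \<phi> n x) \<le> \<kappa>"
      if x: "x \<in> {0<..<1} - (T \<union> dyadic_rationals) - ?Z" for x
    proof -
      have "((\<lambda>t. (\<phi> (x + t) - \<phi> x) / of_real t) \<longlongrightarrow> 0) (at (0::real))" using x by auto
      then have "((\<lambda>t. cmod ((\<phi> (x + t) - \<phi> x) / of_real t - dyadic_slope \<phi> n x)) \<longlongrightarrow> cmod (0 - dyadic_slope \<phi> n x)) (at (0::real))"
        by (intro tendsto_intros)
      from tendsto_upperbound[OF this near[rule_format]] show ?thesis using x by auto
    qed
    \<comment> \<open>The slope is constant on each \<open>J k\<close>, so one unexceptional point
      would already make it small. Steep intervals thus consist of exceptional points.\<close>
    have "(\<Union>k\<in>bad. J k) \<subseteq> T \<union> (dyadic_rationals \<union> ?Z)"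
    proof (rule subsetI, rule ccontr)
      fix x assume "x \<in> (\<Union>k\<in>bad. J k)" and nx: "x \<notin> T \<union> (dyadic_rationals \<union> ?Z)"
      then obtain k where k: "k \<in> bad" "x \<in> J k" by blast
      have "x < real (Suc k) / 2 ^ n" "real k / 2 ^ n < x" using k(2) by (auto simp: J_def)
      moreover have "real (Suc k) \<le> 2 ^ n"
        using k(1) of_nat_mono[of "Suc k" "2 ^ n", where 'a = real] by (simp add: bad_def)
      then have "real (Suc k) / 2 ^ n \<le> 1" by simp
      moreover have "0 \<le> real k / 2 ^ n" by simp
      ultimately have "x \<in> {0<..<1}" unfolding greaterThanLessThan_iff by linarith
      then have "cmod (dyadic_slope \<phi> n x) \<le> \<kappa>" using nx by (intro slope_le) auto
      then have "2 ^ n * cmod (d k) \<le> \<kappa>"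
        by (simp add: dyadic_slope_def floorJ[OF k(2)] norm_mult norm_power d_def)
      then show False using k(1) by (simp add: bad_def field_simps)
    qed
    moreover have neg: "negligible (dyadic_rationals \<union> ?Z)"
      using negligible_dyadic_rationals zero by (rule negligible_Un)
    ultimately have "measure lebesgue (\<Union>k\<in>bad. J k) \<le> measure lebesgue (T \<union> (dyadic_rationals \<union> ?Z))"
      using fmeasurable.Un[OF T(1) negligible_imp_measurable[OF neg]] fin(1)
      by (intro measure_mono_fmeasurable) (auto simp: J_def)
    also have "\<dots> \<le> measure lebesgue T + measure lebesgue (dyadic_rationals \<union> ?Z)"
      using T(1) neg by (intro measure_Un_le) (auto dest: fmeasurableD negligible_imp_sets)
    also have "\<dots> \<le> \<epsilon>"
      using T(2) negligible_imp_measure0[OF neg] by simp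
    also have "measure lebesgue (\<Union>k\<in>bad. J k) = (\<Sum>k\<in>bad. measure lebesgue (J k))"
    proof (rule measure_UNION')
      show "pairwise (\<lambda>i j. disjnt (J i) (J j)) bad"
      proof (intro pairwiseI)
        fix i j :: nat assume "i \<noteq> j"
        have "i = j" if "x \<in> J i" "x \<in> J j" for x
          using floorJ[OF that(1)] floorJ[OF that(2)] by simp
        with \<open>i \<noteq> j\<close> show "disjnt (J i) (J j)" by (auto simp: disjnt_iff)
      qed
    qed (auto simp: J_def fin)
    also have "\<dots> = (\<Sum>k\<in>bad. 1 / 2 ^ n)"
      by (intro sum.cong) (auto simp: J_def field_simps)
    finally have bad_le: "card bad / 2 ^ n \<le> \<epsilon>" by simp
    have "(cmod (sum d bad))\<^sup>2 \<le> card bad * (\<Sum>k\<in>bad. (cmod (d k))\<^sup>2)"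
      by (rule norm_sum_squared_le)
    also have "\<dots> \<le> card bad * (\<Sum>k<2 ^ n. (cmod (d k))\<^sup>2)"
      using fin by (intro mult_left_mono sum_mono2) auto
    also have "\<dots> = (card bad / 2 ^ n) * dyadic_energy \<phi> n"
      by (simp add: dyadic_energy_def d_def)
    also have "\<dots> \<le> \<epsilon> * M"
      using bad_le energy[of n] \<open>\<epsilon> > 0\<close>
      by (intro mult_mono) (auto simp: dyadic_energy_def sum_nonneg)
    also have "\<dots> \<le> \<kappa>\<^sup>2"
      using \<open>M \<ge> 0\<close> by (simp add: \<epsilon>_def field_simps)
    finally have "cmod (sum d bad) \<le> \<kappa>" using \<open>\<kappa> > 0\<close> by (simp add: power2_le_iff_abs_le)
    moreover have "cmod (sum d ({..<2 ^ n} - bad)) \<le> \<kappa>"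
    proof -
      have "cmod (sum d ({..<2 ^ n} - bad)) \<le> (\<Sum>k\<in>{..<2 ^ n} - bad. \<kappa> / 2 ^ n)"
        by (intro sum_norm_le) (auto simp: bad_def)
      also have "\<dots> \<le> (\<Sum>k\<in>{..<2 ^ n :: nat}. \<kappa> / 2 ^ n)"
        using \<open>\<kappa> > 0\<close> by (intro sum_mono2) auto
      finally show ?thesis by simp
    qed
    moreover have "\<phi> 1 - \<phi> 0 = sum d ({..<2 ^ n} - bad) + sum d bad"
      using sum_dyadic_incr[of 0 "2 ^ n" \<phi> n] sum.subset_diff[OF fin(2), of d]
      by (simp add: d_def lessThan_atLeast0)
    ultimately show ?thesis
      using norm_triangle_ineq[of "sum d ({..<2 ^ n} - bad)" "sum d bad"] by simp
  qed
  have "cmod (\<phi> 1 - \<phi> 0) \<le> 0 + e" if "e > 0" for e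
    using that *[of "e / 2"] by simp
  then have "cmod (\<phi> 1 - \<phi> 0) \<le> 0" by (rule field_le_epsilon)
  then show ?thesis by simp
qed

section \<open>Weakly quasisymmetric homeomorphisms of the plane\<close>

definition strip :: "real \<Rightarrow> real \<Rightarrow> complex set" where
  "strip y r = {z. 0 < Re z \<and> Re z < 1 \<and> \<bar>Im z - y\<bar> < r}"

lemma open_strip: "open (strip y r)"
  unfolding strip_def by (intro open_Collect_conj open_Collect_less continuous_intros)

lemma bounded_strip: "bounded (strip y r)"
proof (rule boundedI)
  fix z assume "z \<in> strip y r"
  then have "\<bar>Re z\<bar> \<le> 1" "\<bar>Im z\<bar> \<le> \<bar>y\<bar> + \<bar>r\<bar>" by (auto simp: strip_def)
  then show "cmod z \<le> 1 + (\<bar>y\<bar> + \<bar>r\<bar>)" using cmod_le[of z] by linarith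
qed

text \<open>Carrying the inverse \<open>g\<close> as a parameter lets images under \<open>f\<close>
  be written as preimages under \<open>g\<close>, which are open for open sets.\<close>

locale weakly_quasisymmetric =
  fixes f g :: "complex \<Rightarrow> complex" and K :: real
  assumes cont_f: "continuous_on UNIV f" and cont_g: "continuous_on UNIV g"
    and g_f: "g (f z) = z" and f_g: "f (g w) = w"
    and K_pos: "K > 0"
    and distortion: "cmod (a - z) \<le> cmod (b - z) \<Longrightarrow> cmod (f a - f z) \<le> K * cmod (f b - f z)"
begin

text \<open>A similarity scales all distances by one factor, so \<open>K\<close> persists.
  Precomposition with it turns the derivative in direction \<open>v\<close> into one in direction
  1.\<close>

lemma affine:
  assumes "v \<noteq> 0"
  shows "weakly_quasisymmetric (\<lambda>z. f (v * z + c)) (\<lambda>w. (g w - c) / v) K"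
proof
  show "continuous_on UNIV (\<lambda>z. f (v * z + c))"
    by (rule continuous_on_compose2[OF cont_f]) (auto intro!: continuous_intros)
  show "continuous_on UNIV (\<lambda>w. (g w - c) / v)"
    using assms by (intro continuous_intros cont_g) auto
  fix a z b :: complex assume "cmod (a - z) \<le> cmod (b - z)"
  then have "cmod (v * a + c - (v * z + c)) \<le> cmod (v * b + c - (v * z + c))"
    by (simp add: norm_mult mult_left_mono flip: right_diff_distrib)
  then show "cmod (f (v * a + c) - f (v * z + c)) \<le> K * cmod (f (v * b + c) - f (v * z + c))"
    by (rule distortion)
qed (use assms K_pos in \<open>auto simp: g_f f_g\<close>)

section \<open>Image areas and the energy on horizontal segments\<close>

lemma open_vimage_g: "open U \<Longrightarrow> open (g -` U)"
  using cont_g by (simp add: open_vimage continuous_on_eq_continuous_within)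

lemma fmeasurable_vimage_g:
  assumes "open U" "bounded U"
  shows "g -` U \<in> fmeasurable lborel"
proof (rule fmeasurableI)
  show "g -` U \<in> sets lborel"
    using open_vimage_g[OF assms(1)] by simp
  have "g -` U \<subseteq> f ` closure U"
    using closure_subset f_g by (metis image_eqI subsetD subsetI vimageD)
  moreover have "compact (f ` closure U)"
    using assms(2) by (intro compact_continuous_image continuous_on_subset[OF cont_f]) auto
  ultimately have "bounded (g -` U)"
    using bounded_subset compact_imp_bounded by blast
  then show "emeasure lborel (g -` U) < \<infinity>"
    by (rule emeasure_bounded_finite)
qed

text \<open>The image of the ball contains the round disc of radius
  \<open>cmod (f b - f z) / K\<close> about \<open>f z\<close>: a point whose preimage is at
  distance at least \<open>r\<close> from \<open>z\<close> is, by distortion, outside that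
  disc.\<close>

lemma area_vimage_ball:
  assumes "r > 0" "cmod (b - z) \<le> r"
  shows "(cmod (f b - f z))\<^sup>2 \<le> K\<^sup>2 / pi * measure lborel (g -` ball z r)"
proof -
  define \<rho> where "\<rho> = cmod (f b - f z) / K"
  have "ball (f z) \<rho> \<subseteq> g -` ball z r"
  proof
    fix w assume "w \<in> ball (f z) \<rho>"
    then have w: "K * cmod (w - f z) < cmod (f b - f z)"
      using K_pos by (simp add: \<rho>_def dist_norm norm_minus_commute field_simps)
    have "cmod (g w - z) < r"
    proof (rule ccontr)
      assume "\<not> cmod (g w - z) < r"
      then have "cmod (f b - f z) \<le> K * cmod (f (g w) - f z)"
        using assms(2) by (intro distortion) auto
      then show False using w by (simp add: f_g)
    qed
    then show "w \<in> g -` ball z r" by (simp add: dist_norm norm_minus_commute)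
  qed
  then have "measure lborel (ball (f z) \<rho>) \<le> measure lborel (g -` ball z r)"
    by (intro measure_mono_fmeasurable fmeasurable_vimage_g) auto
  moreover have "measure lborel (ball (f z) \<rho>) = pi * \<rho>\<^sup>2"
    using K_pos by (simp add: content_ball unit_ball_vol_2 \<rho>_def)
  ultimately have "K\<^sup>2 / pi * (pi * \<rho>\<^sup>2) \<le> K\<^sup>2 / pi * measure lborel (g -` ball z r)"
    by (intro mult_left_mono) auto
  then show ?thesis
    using K_pos by (simp add: \<rho>_def power_divide)
qed

text \<open>The balls having the dyadic segments as diameters are disjoint and lie in the strip, so
  their image areas add up. Each increment passes through the image of the midpoint, which gives the
  constant 4.\<close>

lemma dyadic_energy_le_area:
  "dyadic_energy (\<lambda>x. f (Complex x y)) n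
     \<le> 4 * K\<^sup>2 / pi * 2 ^ n * measure lborel (g -` strip y (1 / 2 ^ n))"
proof -
  define c where "c j = Complex ((real j + 1 / 2) / 2 ^ n) y" for j :: nat
  define r :: real where "r = 1 / 2 / 2 ^ n"
  define D where "D j = g -` ball (c j) r" for j
  have r: "r > 0" by (simp add: r_def)
  have D: "D j \<in> fmeasurable lborel" for j
    unfolding D_def by (intro fmeasurable_vimage_g) auto
  have incr: "(cmod (dyadic_incr (\<lambda>x. f (Complex x y)) n j))\<^sup>2 \<le> 4 * K\<^sup>2 / pi * measure lborel (D j)" for j
  proof -
    define e e' where "e = Complex (real j / 2 ^ n) y" and "e' = Complex (real (Suc j) / 2 ^ n) y"
    have "e - c j = of_real (- r)" "e' - c j = of_real r"
      by (simp_all add: e_def e'_def c_def r_def complex_eq_iff field_simps)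
    then have dist: "cmod (e - c j) \<le> r" "cmod (e' - c j) \<le> r"
      using r by (simp_all only: norm_of_real)
    have "cmod (f e' - f e) \<le> cmod (f e' - f (c j)) + cmod (f e - f (c j))"
      by (metis norm_diff_triangle_ineq norm_triangle_ineq4 diff_diff_eq2 diff_add_cancel)
    then have "(cmod (f e' - f e))\<^sup>2 \<le> (cmod (f e' - f (c j)) + cmod (f e - f (c j)))\<^sup>2"
      by (intro power_mono) auto
    also have "\<dots> \<le> 2 * (cmod (f e' - f (c j)))\<^sup>2 + 2 * (cmod (f e - f (c j)))\<^sup>2"
      using sum_squares_bound[of "cmod (f e' - f (c j))" "cmod (f e - f (c j))"]
      by (simp add: power2_sum)
    also have "\<dots> \<le> 2 * (K\<^sup>2 / pi * measure lborel (D j)) + 2 * (K\<^sup>2 / pi * measure lborel (D j))"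
      unfolding D_def by (intro add_mono mult_left_mono area_vimage_ball r dist) auto
    finally show ?thesis by (simp add: dyadic_incr_def e_def e'_def mult_ac)
  qed
  have Re_c: "real j / 2 ^ n < Re z \<and> Re z < real (Suc j) / 2 ^ n \<and> \<bar>Im z - y\<bar> < 1 / 2 ^ n" if "z \<in> ball (c j) r" for z j
  proof -
    have "cmod (z - c j) < r" using that by (simp add: dist_norm norm_minus_commute)
    then have "\<bar>Re (z - c j)\<bar> < r" "\<bar>Im (z - c j)\<bar> < r"
      using abs_Re_le_cmod[of "z - c j"] abs_Im_le_cmod[of "z - c j"] by linarith+
    moreover have "Re (c j) - r = real j / 2 ^ n" "Re (c j) + r = real (Suc j) / 2 ^ n"
      by (simp_all add: c_def r_def field_simps)
    moreover have "r \<le> 1 / 2 ^ n" by (simp add: r_def field_simps)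
    ultimately show ?thesis by (simp add: c_def abs_less_iff)
  qed
  have "pairwise (\<lambda>i j. disjnt (D i) (D j)) {..<2 ^ n}"
  proof (intro pairwiseI)
    fix i j :: nat assume "i \<noteq> j"
    \<comment> \<open>The open ball stays strictly between two dyadic vertical lines, so the floor
      recovers its index.\<close>
    have "\<lfloor>2 ^ n * Re z\<rfloor> = int j" if "z \<in> ball (c j) r" for z j
      using Re_c[OF that] by (intro floor_unique) (auto simp: field_simps)
    with \<open>i \<noteq> j\<close> show "disjnt (D i) (D j)"
      unfolding D_def disjnt_iff by (metis of_nat_eq_iff vimageE)
  qed
  then have sum: "(\<Sum>j<2 ^ n. measure lborel (D j)) = measure lborel (\<Union>j<2 ^ n. D j)"
    by (intro measure_UNION'[symmetric] D) auto
  have "(\<Union>j<2 ^ n. D j) \<subseteq> g -` strip y (1 / 2 ^ n)"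
  proof -
    have "z \<in> strip y (1 / 2 ^ n)" if "j < 2 ^ n" "z \<in> ball (c j) r" for z j
    proof -
      have "real (Suc j) \<le> 2 ^ n"
        using \<open>j < 2 ^ n\<close> of_nat_mono[of "Suc j" "2 ^ n", where 'a = real] by simp
      then have "real (Suc j) / 2 ^ n \<le> 1" by simp
      moreover have "0 \<le> real j / 2 ^ n" by simp
      ultimately show ?thesis
        unfolding strip_def mem_Collect_eq using Re_c[OF that(2)] by linarith
    qed
    then show ?thesis by (auto simp: D_def simp del: mem_ball)
  qed
  then have "measure lborel (\<Union>j<2 ^ n. D j) \<le> measure lborel (g -` strip y (1 / 2 ^ n))"
    using D by (intro measure_mono_fmeasurable fmeasurable_vimage_g open_strip bounded_strip sets.finite_UN)
      (use fmeasurableD[OF D] in auto)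
  then have area: "2 ^ n * (4 * K\<^sup>2 / pi * (\<Sum>j<2 ^ n. measure lborel (D j)))
      \<le> 2 ^ n * (4 * K\<^sup>2 / pi * measure lborel (g -` strip y (1 / 2 ^ n)))"
    unfolding sum by (intro mult_left_mono) auto
  have "dyadic_energy (\<lambda>x. f (Complex x y)) n \<le> 2 ^ n * (4 * K\<^sup>2 / pi * (\<Sum>j<2 ^ n. measure lborel (D j)))"
    unfolding dyadic_energy_def sum_distrib_left[of "4 * K\<^sup>2 / pi"]
    by (intro mult_left_mono sum_mono incr) auto
  from order_trans[OF this area] show ?thesis by (simp add: mult_ac)
qed

text \<open>By Tonelli, a point \<open>w\<close> is counted only for \<open>y\<close> within
  \<open>r\<close> of \<open>Im (g w)\<close>, a set of length at most \<open>2 * r\<close>. Since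
  \<open>y < 1\<close> and \<open>r \<le> 1\<close>, only points with \<open>g w\<close> in
  \<open>strip 0 2\<close> occur.\<close>

lemma nn_integral_strip_area:
  assumes "0 < r" "r \<le> 1"
  shows "(\<integral>\<^sup>+y. c * (emeasure lborel (g -` strip y r) * indicator {0<..<1} y) \<partial>lborel)
     \<le> c * (2 * ennreal r * emeasure lborel (g -` strip 0 2))"
proof -
  define X where "X = {p. 0 < fst p \<and> fst p < 1 \<and> 0 < Re (g (snd p)) \<and> Re (g (snd p)) < 1 \<and> \<bar>Im (g (snd p)) - fst p\<bar> < r}"
  have cont: "continuous_on UNIV (\<lambda>p :: real \<times> complex. g (snd p))"
    by (rule continuous_on_compose2[OF cont_g]) (auto intro!: continuous_intros)
  have "open X"
    unfolding X_def by (intro open_Collect_conj open_Collect_less continuous_intros cont)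
  then have X: "X \<in> sets (lborel \<Otimes>\<^sub>M lborel)"
    unfolding lborel_prod by simp
  have "Pair y -` X = (if y \<in> {0<..<1} then g -` strip y r else {})" for y
    by (auto simp: X_def strip_def)
  then have "(\<integral>\<^sup>+y. c * (emeasure lborel (g -` strip y r) * indicator {0<..<1} y) \<partial>lborel)
      = (\<integral>\<^sup>+y. c * emeasure lborel (Pair y -` X) \<partial>lborel)"
    by (intro nn_integral_cong) (auto simp: indicator_def)
  also have "\<dots> = c * (\<integral>\<^sup>+y. emeasure lborel (Pair y -` X) \<partial>lborel)"
    by (intro nn_integral_cmult lborel.measurable_emeasure_Pair X)
  also have "(\<integral>\<^sup>+y. emeasure lborel (Pair y -` X) \<partial>lborel) = emeasure (lborel \<Otimes>\<^sub>M lborel) X"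
    by (rule lborel.emeasure_pair_measure_alt[OF X, symmetric])
  also have "\<dots> = (\<integral>\<^sup>+w. emeasure lborel ((\<lambda>y. (y, w)) -` X) \<partial>lborel)"
    by (rule lborel_pair.emeasure_pair_measure_alt2[OF X])
  also have "c * \<dots> \<le> c * (\<integral>\<^sup>+w. 2 * ennreal r * indicator (g -` strip 0 2) w \<partial>lborel)"
  proof (intro mult_left_mono nn_integral_mono)
    fix w
    show "emeasure lborel ((\<lambda>y. (y, w)) -` X) \<le> 2 * ennreal r * indicator (g -` strip 0 2) w"
    proof (cases "g w \<in> strip 0 2")
      case True
      have "(\<lambda>y. (y, w)) -` X \<subseteq> {Im (g w) - r..Im (g w) + r}" by (auto simp: X_def)
      then have "emeasure lborel ((\<lambda>y. (y, w)) -` X) \<le> emeasure lborel {Im (g w) - r..Im (g w) + r}"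
        by (intro emeasure_mono) auto
      also have "\<dots> = ennreal (2 * r)" using assms by simp
      finally show ?thesis using True assms by (simp add: ennreal_mult)
    next
      case False
      then have "(\<lambda>y. (y, w)) -` X = {}" using assms by (auto simp: X_def strip_def)
      then show ?thesis by simp
    qed
  qed auto
  also have "(\<integral>\<^sup>+w. 2 * ennreal r * indicator (g -` strip 0 2) w \<partial>lborel) = 2 * ennreal r * emeasure lborel (g -` strip 0 2)"
    using open_vimage_g[OF open_strip] by (subst nn_integral_cmult_indicator) auto
  finally show ?thesis .
qed

text \<open>The factor \<open>2 ^ n\<close> in the energy bound cancels the width of the strip, so
  the integrals of the energies over \<open>y\<close> are uniformly bounded. The energies increase
  with \<open>n\<close>; by monotone convergence their supremum is integrable, hence finite almost
  everywhere.\<close>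

lemma AE_dyadic_energy_bounded:
  "AE y in lborel. y \<in> {0<..<1} \<longrightarrow> (\<exists>M. \<forall>n. dyadic_energy (\<lambda>x. f (Complex x y)) n \<le> M)"
proof -
  define E where "E n y = dyadic_energy (\<lambda>x. f (Complex x y)) n" for n y
  define F where "F n y = ennreal (E n y) * indicator {0<..<1} y" for n y
  define C where "C = 4 * K\<^sup>2 / pi"
  have "C \<ge> 0" by (simp add: C_def)
  have contE: "continuous_on UNIV (E n)" for n
    unfolding E_def dyadic_energy_def dyadic_incr_def
    by (intro continuous_intros continuous_on_compose2[OF cont_f]) (auto simp: Complex_eq intro!: continuous_intros)
  have measF: "F n \<in> borel_measurable lborel" for n
    unfolding F_def using borel_measurable_continuous_onI[OF contE] by simp
  have "incseq F"
    unfolding F_def incseq_def le_fun_def E_def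
    by (intro allI impI mult_right_mono ennreal_leI incseqD[OF incseq_dyadic_energy]) auto
  have intF: "(\<integral>\<^sup>+y. F n y \<partial>lborel) \<le> ennreal (2 * C) * emeasure lborel (g -` strip 0 2)" for n
  proof -
    have "(\<integral>\<^sup>+y. F n y \<partial>lborel)
        \<le> (\<integral>\<^sup>+y. ennreal (C * 2 ^ n) * (emeasure lborel (g -` strip y (1 / 2 ^ n)) * indicator {0<..<1} y) \<partial>lborel)"
    proof (rule nn_integral_mono)
      fix y
      have "ennreal (E n y) \<le> ennreal (C * 2 ^ n * measure lborel (g -` strip y (1 / 2 ^ n)))"
        unfolding E_def C_def by (intro ennreal_leI dyadic_energy_le_area)
      also have "\<dots> = ennreal (C * 2 ^ n) * emeasure lborel (g -` strip y (1 / 2 ^ n))"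
        using \<open>C \<ge> 0\<close> by (simp add: ennreal_mult emeasure_eq_measure2[OF fmeasurable_vimage_g] open_strip bounded_strip)
      finally show "F n y \<le> ennreal (C * 2 ^ n) * (emeasure lborel (g -` strip y (1 / 2 ^ n)) * indicator {0<..<1} y)"
        by (simp add: F_def indicator_def)
    qed
    also have "\<dots> \<le> ennreal (C * 2 ^ n) * (2 * ennreal (1 / 2 ^ n) * emeasure lborel (g -` strip 0 2))"
      by (intro nn_integral_strip_area) auto
    also have "\<dots> = ennreal (2 * C) * emeasure lborel (g -` strip 0 2)"
    proof -
      have "2 * ennreal (1 / 2 ^ n) = ennreal (2 * (1 / 2 ^ n))"
        by (subst ennreal_mult) auto
      then have "ennreal (C * 2 ^ n) * (2 * ennreal (1 / 2 ^ n)) = ennreal (C * 2 ^ n * (2 * (1 / 2 ^ n)))"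
        using \<open>C \<ge> 0\<close> by (simp only:) (rule ennreal_mult[symmetric], auto)
      also have "C * 2 ^ n * (2 * (1 / 2 ^ n)) = 2 * C" by simp
      finally show ?thesis by (simp only: mult.assoc[symmetric])
    qed
    finally show ?thesis .
  qed
  have "(\<integral>\<^sup>+y. (SUP n. F n y) \<partial>lborel) = (SUP n. \<integral>\<^sup>+y. F n y \<partial>lborel)"
    by (rule nn_integral_monotone_convergence_SUP[OF \<open>incseq F\<close> measF])
  also have "\<dots> \<le> ennreal (2 * C) * emeasure lborel (g -` strip 0 2)"
    by (intro SUP_least intF)
  also have "\<dots> < \<infinity>"
    using fmeasurableD2[OF fmeasurable_vimage_g[OF open_strip bounded_strip], of 0 2]
    by (simp add: ennreal_mult_less_top less_top)
  finally have "AE y in lborel. (SUP n. F n y) \<noteq> \<infinity>"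
    using measF by (intro nn_integral_PInf_AE) auto
  then show ?thesis
  proof eventually_elim
    case (elim y)
    show ?case
    proof
      assume y: "y \<in> {0<..<1}"
      have "E n y \<le> enn2real (SUP n. F n y)" for n
      proof -
        have "ennreal (E n y) \<le> (SUP n. F n y)"
          by (rule SUP_upper2[of n]) (use y in \<open>auto simp: F_def\<close>)
        moreover have "(SUP n. F n y) < top"
          using elim by (simp only: infinity_ennreal_def top.not_eq_extremum)
        ultimately have "enn2real (ennreal (E n y)) \<le> enn2real (SUP n. F n y)"
          by (rule enn2real_mono)
        moreover have "E n y \<ge> 0" by (simp add: E_def dyadic_energy_def sum_nonneg)
        ultimately show ?thesis by simp
      qed
      then show "\<exists>M. \<forall>n. dyadic_energy (\<lambda>x. f (Complex x y)) n \<le> M"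
        unfolding E_def by blast
    qed
  qed
qed

end

section \<open>Directional differentiability as a Borel condition\<close>

definition osc_set :: "(complex \<Rightarrow> complex) \<Rightarrow> complex \<Rightarrow> real \<Rightarrow> complex set" where
  "osc_set f v \<kappa> = {z. \<forall>\<delta>>0. \<exists>s t. s \<noteq> 0 \<and> t \<noteq> 0 \<and> \<bar>s\<bar> < \<delta> \<and> \<bar>t\<bar> < \<delta> \<and>
     cmod ((f (z + v * of_real s) - f z) / of_real s - (f (z + v * of_real t) - f z) / of_real t) > \<kappa>}"

text \<open>Points are written as (imaginary part, real part), so that horizontal lines are the sections
  with fixed first coordinate.\<close>

definition nondiff :: "(complex \<Rightarrow> complex) \<Rightarrow> complex \<Rightarrow> (real \<times> real) set" where
  "nondiff f v = {(y, x). \<exists>k::nat. Complex x y \<in> osc_set f v (1 / real (Suc k))}"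

text \<open>This is the Cauchy criterion for the difference quotient at 0: completeness gives a
  limit along \<open>1 / real (Suc n)\<close>, and small oscillation extends it to all small
  \<open>t\<close>.\<close>

lemma has_dir_deriv_if_not_nondiff:
  assumes "(y, x) \<notin> nondiff f v"
  obtains L where "has_dir_deriv f (Complex x y) v L"
proof -
  define q where "q t = (f (Complex x y + v * of_real t) - f (Complex x y)) / of_real t" for t :: real
  have cauchy: "\<exists>\<delta>>0. \<forall>s t. s \<noteq> 0 \<and> t \<noteq> 0 \<and> \<bar>s\<bar> < \<delta> \<and> \<bar>t\<bar> < \<delta> \<longrightarrow> dist (q s) (q t) < e" if "e > 0" for e
  proof -
    obtain k where k: "1 / real (Suc k) < e" using nat_approx_posE[OF \<open>e > 0\<close>] by blast
    have "Complex x y \<notin> osc_set f v (1 / real (Suc k))" using assms by (auto simp: nondiff_def)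
    then obtain \<delta> where "\<delta> > 0"
      "\<And>s t. s \<noteq> 0 \<Longrightarrow> t \<noteq> 0 \<Longrightarrow> \<bar>s\<bar> < \<delta> \<Longrightarrow> \<bar>t\<bar> < \<delta> \<Longrightarrow> cmod (q s - q t) \<le> 1 / real (Suc k)"
      unfolding osc_set_def q_def mem_Collect_eq not_all not_imp not_ex by (meson not_le)
    then show ?thesis using k by (intro exI[of _ \<delta>]) (force simp: dist_norm)
  qed
  define X where "X n = q (1 / real (Suc n))" for n
  have small: "\<exists>N. \<forall>n\<ge>N. \<bar>1 / real (Suc n)\<bar> < \<delta>" if "\<delta> > 0" for \<delta>
  proof -
    obtain N where N: "1 / real (Suc N) < \<delta>" using nat_approx_posE[OF \<open>\<delta> > 0\<close>] by blast
    have "1 / real (Suc n) \<le> 1 / real (Suc N)" if "N \<le> n" for n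
      using that by (intro frac_le) auto
    then show ?thesis using N by (intro exI[of _ N]) fastforce
  qed
  have "Cauchy X"
    unfolding Cauchy_def
  proof (intro allI impI)
    fix e :: real assume "e > 0"
    then obtain \<delta> where \<delta>: "\<delta> > 0"
      "\<And>s t. s \<noteq> 0 \<Longrightarrow> t \<noteq> 0 \<Longrightarrow> \<bar>s\<bar> < \<delta> \<Longrightarrow> \<bar>t\<bar> < \<delta> \<Longrightarrow> dist (q s) (q t) < e"
      using cauchy by metis
    obtain N where N: "\<forall>n\<ge>N. \<bar>1 / real (Suc n)\<bar> < \<delta>" using small[OF \<delta>(1)] by blast
    show "\<exists>M. \<forall>m\<ge>M. \<forall>n\<ge>M. dist (X m) (X n) < e"
      unfolding X_def using N by (intro exI[of _ N] allI impI \<delta>(2)) auto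
  qed
  then obtain L where L: "X \<longlonglongrightarrow> L" using Cauchy_convergent convergent_def by blast
  have "(q \<longlongrightarrow> L) (at 0)"
    unfolding tendsto_iff eventually_at
  proof (intro allI impI)
    fix e :: real assume "e > 0"
    then obtain \<delta> where \<delta>: "\<delta> > 0"
      "\<And>s t. s \<noteq> 0 \<Longrightarrow> t \<noteq> 0 \<Longrightarrow> \<bar>s\<bar> < \<delta> \<Longrightarrow> \<bar>t\<bar> < \<delta> \<Longrightarrow> dist (q s) (q t) < e / 2"
      using cauchy[of "e / 2"] by (metis half_gt_zero)
    obtain N where N: "\<forall>n\<ge>N. \<bar>1 / real (Suc n)\<bar> < \<delta>" using small[OF \<delta>(1)] by blast
    obtain M where M: "\<forall>n\<ge>M. dist (X n) L < e / 2"
      using L \<open>e > 0\<close> unfolding lim_sequentially by (meson half_gt_zero)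
    have "dist (q t) L < e" if "t \<noteq> 0" "dist t 0 < \<delta>" for t
    proof -
      have "dist (q t) (X (max M N)) < e / 2"
        unfolding X_def using N that by (intro \<delta>(2)) auto
      moreover have "dist (X (max M N)) L < e / 2" using M by simp
      ultimately show ?thesis
        using dist_triangle[of "q t" L "X (max M N)"] by linarith
    qed
    then show "\<exists>d>0. \<forall>x\<in>UNIV. x \<noteq> 0 \<and> dist x 0 < d \<longrightarrow> dist (q x) L < e"
      using \<delta>(1) by blast
  qed
  then have "has_dir_deriv f (Complex x y) v L" by (simp add: has_dir_deriv_def q_def[abs_def])
  then show thesis by (rule that)
qed

text \<open>For fixed nonzero \<open>s\<close> and \<open>t\<close> the oscillation condition is
  open in the base point, and stays open under the uncountable union over \<open>s\<close> and
  \<open>t\<close>. Restricting \<open>\<delta>\<close> to \<open>1 / real (Suc l)\<close> leaves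
  only countable operations.\<close>

lemma borel_nondiff:
  assumes "continuous_on UNIV f"
  shows "nondiff f v \<in> sets borel"
proof -
  define Q where "Q p s = (f (Complex (snd p) (fst p) + v * of_real s) - f (Complex (snd p) (fst p))) / of_real s"
    for p :: "real \<times> real" and s :: real
  have cont: "continuous_on UNIV (\<lambda>p. Q p s)" if "s \<noteq> 0" for s
    unfolding Q_def Complex_eq using that
    by (intro continuous_intros continuous_on_compose2[OF assms]) (auto intro!: continuous_intros)
  define U where "U k l = (\<Union>s\<in>{s. s \<noteq> 0 \<and> \<bar>s\<bar> < 1 / real (Suc l)}. \<Union>t\<in>{t. t \<noteq> 0 \<and> \<bar>t\<bar> < 1 / real (Suc l)}.
      {p. 1 / real (Suc k) < cmod (Q p s - Q p t)})" for k l :: nat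
  have "open (U k l)" for k l
    unfolding U_def by (intro open_UN ballI open_Collect_less continuous_intros cont) auto
  then have "(\<Union>k. \<Inter>l. U k l) \<in> sets borel" by (intro sets.countable_UN sets.countable_INT) auto
  moreover have "nondiff f v = (\<Union>k. \<Inter>l. U k l)"
  proof -
    have osc_iff: "Complex x y \<in> osc_set f v (1 / real (Suc k)) \<longleftrightarrow> (\<forall>l. (y, x) \<in> U k l)" for x y k
    proof
      assume osc: "Complex x y \<in> osc_set f v (1 / real (Suc k))"
      show "\<forall>l. (y, x) \<in> U k l"
      proof
        fix l :: nat
        have "1 / real (Suc l) > 0" by simp
        then obtain s t where "s \<noteq> 0" "t \<noteq> 0" "\<bar>s\<bar> < 1 / real (Suc l)" "\<bar>t\<bar> < 1 / real (Suc l)"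
          "1 / real (Suc k) < cmod (Q (y, x) s - Q (y, x) t)"
          using osc unfolding osc_set_def mem_Collect_eq Q_def fst_conv snd_conv by meson
        then show "(y, x) \<in> U k l" unfolding U_def by blast
      qed
    next
      assume U: "\<forall>l. (y, x) \<in> U k l"
      show "Complex x y \<in> osc_set f v (1 / real (Suc k))"
        unfolding osc_set_def mem_Collect_eq
      proof (intro allI impI)
        fix \<delta> :: real assume "\<delta> > 0"
        then obtain l where l: "1 / real (Suc l) < \<delta>" using nat_approx_posE by blast
        obtain s t where "s \<noteq> 0" "\<bar>s\<bar> < 1 / real (Suc l)" "t \<noteq> 0" "\<bar>t\<bar> < 1 / real (Suc l)"
          "1 / real (Suc k) < cmod (Q (y, x) s - Q (y, x) t)"
          using U[rule_format, of l] unfolding U_def by blast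
        then show "\<exists>s t. s \<noteq> 0 \<and> t \<noteq> 0 \<and> \<bar>s\<bar> < \<delta> \<and> \<bar>t\<bar> < \<delta> \<and>
          cmod ((f (Complex x y + v * of_real s) - f (Complex x y)) / of_real s
            - (f (Complex x y + v * of_real t) - f (Complex x y)) / of_real t) > 1 / real (Suc k)"
          using l unfolding Q_def fst_conv snd_conv by (intro exI[of _ s] exI[of _ t] conjI) linarith+
      qed
    qed
    show ?thesis
    proof (rule set_eqI)
      fix p
      show "p \<in> nondiff f v \<longleftrightarrow> p \<in> (\<Union>k. \<Inter>l. U k l)"
        by (cases p) (simp add: nondiff_def osc_iff del: of_nat_Suc)
    qed
  qed
  ultimately show ?thesis by simp
qed

lemma emeasure_lborel_eq_0_if_negligible:
  assumes "negligible S" "S \<in> sets borel"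
  shows "emeasure lborel S = 0"
proof -
  have "S \<in> null_sets lborel"
    using assms null_sets_completion_iff[of S lborel] by (simp add: negligible_iff_null_sets)
  then show ?thesis by (rule null_setsD1)
qed

section \<open>From almost every line to almost every point\<close>

context weakly_quasisymmetric
begin

lemma continuous_on_horizontal: "continuous_on UNIV (\<lambda>x. f (Complex x y))"
  unfolding Complex_eq by (intro continuous_on_compose2[OF cont_f] continuous_intros) auto

text \<open>Almost every horizontal section has bounded energy, so the one-dimensional result makes
  it null; Tonelli then applies to this Borel set.\<close>

lemma negligible_nondiff_unit_square:
  "negligible (nondiff f 1 \<inter> {0<..<1} \<times> {0<..<1})"
proof -
  define N where "N = nondiff f 1 \<inter> {0<..<1} \<times> {0<..<1}"
  have "open ({0<..<1::real} \<times> {0<..<1::real})" by (intro open_Times) auto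
  then have borelN: "N \<in> sets borel"
    unfolding N_def using borel_nondiff[OF cont_f] by auto
  then have N: "N \<in> sets (lborel \<Otimes>\<^sub>M lborel)" unfolding lborel_prod by simp
  have section_borel: "Pair y -` N \<in> sets borel" for y
    using sets_Pair1[OF N] by simp
  have "AE y in lborel. emeasure lborel (Pair y -` N) = 0"
    using AE_dyadic_energy_bounded
  proof eventually_elim
    case (elim y)
    show ?case
    proof (cases "y \<in> {0<..<1}")
      case True
      then obtain M where M: "\<And>n. dyadic_energy (\<lambda>x. f (Complex x y)) n \<le> M" using elim by blast
      have shift: "Complex x y + 1 * of_real s = Complex (x + s) y" for x s
        by (simp add: complex_eq_iff)
      define A where "A k = {x\<in>{0<..<1}. Complex x y \<in> osc_set f 1 (1 / real (Suc k))}" for k :: nat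
      have "negligible (A k)" for k
        unfolding A_def osc_set_def mem_Collect_eq shift
        by (rule negligible_oscillating_quotients[OF continuous_on_horizontal M]) simp
      then have "negligible (\<Union>k. A k)"
        by (intro negligible_countable_Union) auto
      moreover have "Pair y -` N \<subseteq> (\<Union>k. A k)"
        by (auto simp: A_def N_def nondiff_def)
      ultimately show ?thesis
        by (intro emeasure_lborel_eq_0_if_negligible[OF _ section_borel]) (rule negligible_subset)
    next
      case False
      then have "Pair y -` N = {}" by (auto simp: N_def)
      then show ?thesis by simp
    qed
  qed
  then have "(\<integral>\<^sup>+y. emeasure lborel (Pair y -` N) \<partial>lborel) = 0"
    using lborel.measurable_emeasure_Pair[OF N] by (subst nn_integral_0_iff_AE) auto
  then have "emeasure (lborel \<Otimes>\<^sub>M lborel) N = 0"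
    by (simp add: lborel.emeasure_pair_measure_alt[OF N])
  then have "N \<in> null_sets lborel"
    using borelN unfolding lborel_prod by auto
  then show ?thesis
    unfolding N_def[symmetric] negligible_iff_null_sets by (rule null_sets_completionI)
qed

text \<open>In the coordinate \<open>z / v\<close>, direction \<open>v\<close> becomes direction 1.
  Countably many translates of the unit square cover the plane, and the affine change back preserves
  null sets.\<close>

lemma negligible_nondiff:
  assumes "v \<noteq> 0"
  shows "negligible (nondiff f v)"
proof -
  \<comment> \<open>Half-integer translates are taken because open unit squares at integer positions
    would miss the grid lines.\<close>
  define c where "c m n = Complex (of_int m / 2) (of_int n / 2)" for m n :: int
  define F where "F m n z = f (v * z + v * c m n)" for m n z
  define T where "T m n p = (let z = v * (Complex (snd p) (fst p) + c m n) in (Im z, Re z))" for m n and p :: "real \<times> real"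
  define S where "S m n = nondiff (F m n) 1 \<inter> {0<..<1} \<times> {0<..<1}" for m n
  have negS: "negligible (T m n ` S m n)" for m n
  proof -
    \<comment> \<open>Multiplication by \<open>v\<close> in the swapped coordinates (imaginary part,
      real part): the linear part of \<open>T m n\<close>.\<close>
    define L where "L p = (Im v * snd p + Re v * fst p, Re v * snd p - Im v * fst p)" for p :: "real \<times> real"
    have "linear L" by (rule linearI) (auto simp: L_def algebra_simps)
    have "T m n = (\<lambda>p. (Im (v * c m n), Re (v * c m n)) + L p)"
      by (rule ext) (simp add: T_def L_def Let_def algebra_simps)
    then have "T m n ` S m n = (+) (Im (v * c m n), Re (v * c m n)) ` L ` S m n"
      by (simp add: image_image)
    moreover have "negligible (S m n)"
      unfolding S_def F_def by (rule weakly_quasisymmetric.negligible_nondiff_unit_square[OF affine[OF assms]])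
    ultimately show ?thesis
      using negligible_differentiable_image_negligible[OF order_refl _ linear_imp_differentiable_on[OF \<open>linear L\<close>]]
      by (simp add: negligible_translation)
  qed
  have "nondiff f v \<subseteq> (\<Union>m. \<Union>n. T m n ` S m n)"
  proof
    fix p assume "p \<in> nondiff f v"
    obtain y x where p: "p = (y, x)" by fastforce
    obtain k :: nat where k: "Complex x y \<in> osc_set f v (1 / real (Suc k))"
      using \<open>p \<in> nondiff f v\<close> by (auto simp: nondiff_def p)
    define w where "w = Complex x y / v"
    \<comment> \<open>This choice leaves \<open>2 * Re w - m\<close> and \<open>2 * Im w - n\<close>
      in (0, 1], so both coordinates of \<open>z\<close> are in (0, 1/2], inside the open
      square.\<close>
    define m n where "m = \<lceil>2 * Re w\<rceil> - 1" and "n = \<lceil>2 * Im w\<rceil> - 1"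
    define z where "z = w - c m n"
    have vz: "v * z + v * c m n = Complex x y"
      using assms by (simp add: z_def w_def flip: distrib_left)
    have "F m n (z + 1 * of_real s) = f (Complex x y + v * of_real s)" "F m n z = f (Complex x y)" for s :: real
      unfolding F_def vz[symmetric] by (simp_all add: algebra_simps)
    then have "z \<in> osc_set (F m n) 1 (1 / real (Suc k))"
      using k unfolding osc_set_def by simp
    moreover have "Re z \<in> {0<..<1}"
      unfolding z_def c_def m_def by (simp add: field_simps) linarith
    moreover have "Im z \<in> {0<..<1}"
      unfolding z_def c_def n_def by (simp add: field_simps) linarith
    ultimately have "(Im z, Re z) \<in> S m n" by (auto simp: S_def nondiff_def)
    moreover have "T m n (Im z, Re z) = p"
      using vz by (simp add: T_def Let_def p distrib_left)
    ultimately show "p \<in> (\<Union>m. \<Union>n. T m n ` S m n)" by blast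
  qed
  moreover have "negligible (\<Union>m. \<Union>n. T m n ` S m n)"
    using negS by (intro negligible_countable_Union) (auto intro!: negligible_countable_Union)
  ultimately show ?thesis by (rule negligible_subset[rotated])
qed

text \<open>The rational directions are countable, so almost every point has all their derivatives.
  Without an asterisk the derivative in direction 1 would vanish at all those points, and
  \<open>f\<close> would agree at the two ends of almost every horizontal unit segment,
  contradicting injectivity.\<close>

lemma has_asterisk: "has_asterisk f"
proof (rule ccontr)
  assume no_asterisk: "\<not> has_asterisk f"
  define V where "V = {v. v \<noteq> 0 \<and> Re v \<in> \<rat> \<and> Im v \<in> \<rat>}"
  have "V \<subseteq> (\<lambda>(a, b). Complex a b) ` (\<rat> \<times> \<rat>)"
    by (force simp: V_def complex_eq_iff)
  then have "countable V"
    by (rule countable_subset) (intro countable_image countable_SIGMA countable_rat)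
  define N where "N = (\<Union>v\<in>V. nondiff f v)"
  have "negligible N"
    unfolding N_def using \<open>countable V\<close> by (intro negligible_countable_Union) (auto simp: V_def negligible_nondiff)
  moreover have "N \<in> sets borel"
    unfolding N_def using \<open>countable V\<close> by (intro sets.countable_UN') (auto intro!: borel_nondiff cont_f)
  ultimately have "N \<in> null_sets (lborel \<Otimes>\<^sub>M lborel)"
    unfolding lborel_prod by (auto intro: emeasure_lborel_eq_0_if_negligible)
  then have "AE p in lborel \<Otimes>\<^sub>M lborel. p \<notin> N" by (rule AE_not_in)
  then have "AE y in lborel. AE x in lborel. (y, x) \<notin> N" by (rule lborel_pair.AE_pair)
  \<comment> \<open>The contradiction on each good line is recorded as saying that almost every
    \<open>y\<close> avoids (0, 1), which has positive measure.\<close>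
  then have "AE y in lborel. y \<notin> {0<..<1::real}"
    using AE_dyadic_energy_bounded
  proof eventually_elim
    case (elim y)
    show ?case
    proof
      assume "y \<in> {0<..<1}"
      then obtain M where M: "\<And>n. dyadic_energy (\<lambda>x. f (Complex x y)) n \<le> M" using elim(2) by blast
      have zero: "((\<lambda>t. (f (Complex (x + t) y) - f (Complex x y)) / of_real t) \<longlongrightarrow> 0) (at (0::real))"
        if "(y, x) \<notin> N" for x
      proof -
        have deriv: "\<exists>L. has_dir_deriv f (Complex x y) v L" if "v \<in> V" for v
          using has_dir_deriv_if_not_nondiff[of y x f v] \<open>(y, x) \<notin> N\<close> that by (auto simp: N_def)
        have "1 \<in> V" by (simp add: V_def)
        then obtain L where L: "has_dir_deriv f (Complex x y) 1 L" using deriv by blast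
        then have "L = 0"
          using no_asterisk deriv unfolding has_asterisk_def V_def by blast
        moreover have "Complex x y + 1 * of_real t = Complex (x + t) y" for t
          by (simp add: complex_eq_iff)
        ultimately show ?thesis using L by (simp add: has_dir_deriv_def)
      qed
      obtain Z where "{x \<in> space lborel. \<not> (y, x) \<notin> N} \<subseteq> Z" "emeasure lborel Z = 0" "Z \<in> sets lborel"
        using elim(1) by (rule AE_E)
      then have Z: "Z \<in> null_sets lborel" "{x. (y, x) \<in> N} \<subseteq> Z" by auto
      have "negligible {x\<in>{0<..<1}. \<not> ((\<lambda>t. (f (Complex (x + t) y) - f (Complex x y)) / of_real t) \<longlongrightarrow> 0) (at (0::real))}"
        unfolding negligible_iff_null_sets
        by (rule null_sets_completion_subset[OF _ null_sets_completionI[OF Z(1)]]) (use zero Z(2) in blast)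
      from eq_endpoints_if_quotients_tendsto_0[OF continuous_on_horizontal M this]
      have "Complex 1 y = Complex 0 y" by (metis g_f)
      then show False by simp
    qed
  qed
  then have "emeasure lborel {0<..<1::real} = 0"
    by (subst (asm) AE_iff_measurable[of "{0<..<1}"]) auto
  then show False by simp
qed

end

theorem theorem1p7:
  fixes H :: "H3 \<Rightarrow> H3" and h :: "Sph \<Rightarrow> Sph"
    and \<Gamma>1 \<Gamma>2 :: "((H3 \<Rightarrow> H3) \<times> (Sph \<Rightarrow> Sph)) set"
  assumes "equivariant_pair H h \<Gamma>1 \<Gamma>2"
    and "h None = None"
  shows "has_asterisk (\<lambda>z. the (h (Some z)))"
proof -
  have h: "bij h" "cont_S h" "cont_S (inv h)"
    using assms(1) by (auto simp: equivariant_pair_def homeo_S_def)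
  define f where "f z = the (h (Some z))" for z
  define g where "g w = the (inv h (Some w))" for w
  \<comment> \<open>Since \<open>h\<close> is injective and fixes infinity, finite points have
    finite images, so \<open>the\<close> is never applied to \<open>None\<close>.\<close>
  have "h (Some z) \<noteq> None" for z
    using h(1) assms(2) by (metis bij_is_inj injD option.distinct(1))
  then have hf: "h (Some z) = Some (f z)" for z by (simp add: f_def)
  have "inv h (Some w) \<noteq> None" for w
    using h(1) assms(2) by (metis bij_is_surj surj_f_inv_f option.distinct(1))
  then have hg: "inv h (Some w) = Some (g w)" for w by (simp add: g_def)
  obtain K where K: "K > 0"
    "\<And>z a b. cmod (a - z) \<le> cmod (b - z) \<Longrightarrow> cmod (f a - f z) \<le> K * cmod (f b - f z)"
    using equivariant_pair_weakly_quasisymmetric[OF assms(1) hf assms(2)] by blast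
  interpret weakly_quasisymmetric f g K
  proof
    show "continuous_on UNIV f" "continuous_on UNIV g"
      using cont_S_continuous_on_plane[OF h(2) hf] cont_S_continuous_on_plane[OF h(3) hg] by auto
    show "g (f z) = z" for z
      by (metis h(1) hf hg bij_is_inj inv_f_f option.inject)
    show "f (g w) = w" for w
      by (metis h(1) hf hg bij_is_surj surj_f_inv_f option.inject)
  qed (use K in auto)
  show ?thesis using has_asterisk unfolding f_def[abs_def] .
qed

end
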